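(* Let $G$ be a Lie group with Lie algebra $\mathfrak g$. The Euler-Lagrange equations of a Lagrangian $\mathcal L=\mathcal L(g,\xi_1,\xi_2,\eta_0,\eta_1,\eta_2)$ defined on $T(T^2G)\cong(TG\ltimes_\varphi\mathfrak g)\ltimes((\mathfrak g\ltimes\mathfrak g)\ltimes_\theta\mathfrak g)$ are given by $$\frac{d}{dt}\frac{\delta\mathcal L}{\delta\eta_0}=T^*L_g\Big(\frac{\delta\mathcal L}{\delta g}\Big)-\mathrm{ad}^*_{\xi_1}\Big(\frac{\delta\mathcal L}{\delta\xi_1}\Big)-\mathrm{ad}^*_{\xi_2}\Big(\frac{\delta\mathcal L}{\delta\xi_2}\Big)-\mathrm{ad}^*_{\eta_0}\Big(\frac{\delta\mathcal L}{\delta\eta_0}\Big)-\mathrm{ad}^*_{\eta_1}\Big(\frac{\delta\mathcal L}{\delta\eta_1}\Big)-\mathrm{ad}^*_{\eta_2}\Big(\frac{\delta\mathcal L}{\delta\eta_2}\Big),$$ $$\frac{d}{dt}\frac{\delta\mathcal L}{\delta\eta_1}=\frac{\delta\mathcal L}{\delta\xi_1}-\mathrm{ad}^*_{\xi_1}\Big(\frac{\delta\mathcal L}{\delta\xi_2}\Big)-\mathrm{ad}^*_{\eta_0}\Big(\frac{\delta\mathcal L}{\delta\eta_1}\Big)-2\,\mathrm{ad}^*_{\eta_1}\Big(\frac{\delta\mathcal L}{\delta\eta_2}\Big),$$ $$\frac{d}{dt}\frac{\delta\mathcal L}{\delta\eta_2}=T^*L_{\xi_2}\Big(\frac{\delta\mathcal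 L}{\delta\xi_2}\Big)-\mathrm{ad}^*_{\eta_0}\Big(\frac{\delta\mathcal L}{\delta\eta_2}\Big).$$
   Context: $T^2G$ is the group of second order jets at $0$ of curves in $G$ with product $[p][q]=[pq]$; via the left trivialization $[p]\mapsto(p(0),(\delta^\ell p)(0),(\delta^\ell p)'(0))$, $\delta^\ell p=p^{-1}p'$, it is $G\times\mathfrak g\times\mathfrak g$ with product $$(x,\xi_1,\xi_2)(y,\zeta_1,\zeta_2)=(xy,\ \zeta_1+\mathrm{Ad}_{y^{-1}}\xi_1,\ \zeta_2+\mathrm{Ad}_{y^{-1}}\xi_2-\mathrm{ad}_{\zeta_1}\mathrm{Ad}_{y^{-1}}\xi_1).$$ It is thus the 2-cocycle extension $TG\ltimes_\varphi\mathfrak g$ of $TG\cong G\ltimes\mathfrak g$ by $\mathfrak g$, with $\varphi((g_1,\xi_1),(g_2,\xi_2))=-\mathrm{ad}_{\xi_2}\mathrm{Ad}_{g_2^{-1}}\xi_1$. Its Lie algebra is the 2-cocycle extension $(\mathfrak g\ltimes\mathfrak g)\ltimes_\theta\mathfrak g$, with $\theta:(\mathfrak g\ltimes\mathfrak g)\otimes(\mathfrak g\ltimes\mathfrak g)\to\mathfrak g$, $\theta((\xi_1,\xi_2),(\xi_3,\xi_4))=-2\,\mathrm{ad}_{\xi_4}\xi_2$; explicitly, on triples $(\eta_0,\eta_1,\eta_2)\in\mathfrak g^{\times3}$, $$[(\eta_0,\eta_1,\eta_2),(\eta_0',\eta_1',\eta_2')]=\big([\eta_0,\eta_0'],\ [\eta_0,\eta_1']+[\eta_1,\eta_0'],\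 [\eta_0,\eta_2']+[\eta_2,\eta_0']-2\,\mathrm{ad}_{\eta_1'}\eta_1\big).$$ For a Lie group $K$ with Lie algebra $\mathfrak k$, $TK$ is identified with $K\ltimes\mathfrak k$ by left trivialization, and the (trivialized) Euler-Lagrange equations of $\mathcal L=\mathcal L(k,\xi)$ on $K\ltimes\mathfrak k$ are $$\frac{d}{dt}\frac{\delta\mathcal L}{\delta\xi}=T^*L_k\Big(\frac{\delta\mathcal L}{\delta k}\Big)-\mathrm{ad}^*_\xi\Big(\frac{\delta\mathcal L}{\delta\xi}\Big),$$ where $\delta\mathcal L/\delta\xi\in\mathfrak k^*$ and $\delta\mathcal L/\delta k\in T_k^*K$ are partial derivatives, $T^*L_k:T_k^*K\to\mathfrak k^*$ is the transpose of the tangent map at the identity of left translation by $k$, and $\langle\mathrm{ad}^*_\xi\mu,\zeta\rangle=-\langle\mu,[\xi,\zeta]\rangle$. Here $K=T^2G$, $k=(g,\xi_1,\xi_2)$, $\xi=(\eta_0,\eta_1,\eta_2)$. In the claim $\mathrm{ad}^*$ is the coadjoint action of $\mathfrak g$ on $\mathfrak g^*$, $T^*L_g:T_g^*G\to\mathfrak g^*$, and $L_{\xi_2}$ is translation by $\xi_2$ in the additive group $\mathfrak g$ (so $T^*L_{\xi_2}$ is the identity under $T^*_{\xi_2}\mathfrak g=\mathfrak g^*$). *)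

theory Defs
  imports "HOL-Analysis.Analysis" "HOL-Algebra.Group"
begin

section \<open>Smooth maps between normed spaces\<close>

text \<open>
  \<open>Ck_on\<close> is meant for open sets. For a finite-dimensional domain, continuity of all
  directional derivatives \<open>\<lambda>x. f'(x) v\<close> is continuity of \<open>f'\<close>, so this is the usual class \<open>C\<^sup>k\<close>.
\<close>

primrec Ck_on ::
  "nat \<Rightarrow> 'a::real_normed_vector set \<Rightarrow> ('a \<Rightarrow> 'b::real_normed_vector) \<Rightarrow> bool" where
  "Ck_on 0 S f \<longleftrightarrow> continuous_on S f"
| "Ck_on (Suc n) S f \<longleftrightarrow>
     (\<forall>x\<in>S. f differentiable (at x)) \<and> (\<forall>v. Ck_on n S (\<lambda>x. frechet_derivative f (at x) v))"

definition smooth_on :: "'a::real_normed_vector set \<Rightarrow> ('a \<Rightarrow> 'b::real_normed_vector) \<Rightarrow> bool" where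
  "smooth_on S f \<longleftrightarrow> (\<forall>n. Ck_on n S f)"


section \<open>Smooth manifolds\<close>

text \<open>
  An atlas is given as a family of charts \<open>(U\<^sub>p, \<phi>\<^sub>p)\<close> indexed by the points \<open>p\<close> of the manifold,
  with \<open>p \<in> U\<^sub>p\<close>; every smooth manifold has such an atlas. The tangent space at \<open>p\<close> is the model
  space \<open>'e\<close>, a vector \<open>v :: 'e\<close> standing for the tangent vector \<open>(T\<^sub>p\<phi>\<^sub>p)\<inverse> v\<close>. Accordingly the
  cotangent space at \<open>p\<close> is the dual \<open>'e \<Rightarrow>\<^sub>L real\<close>.
\<close>

type_synonym ('m, 'e) charts = "'m \<Rightarrow> 'm set \<times> ('m \<Rightarrow> 'e)"

definition chart_dom :: "('m, 'e) charts \<Rightarrow> 'm \<Rightarrow> 'm set" where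
  "chart_dom c p = fst (c p)"

definition chart_map :: "('m, 'e) charts \<Rightarrow> 'm \<Rightarrow> 'm \<Rightarrow> 'e" where
  "chart_map c p = snd (c p)"

definition chart_inv :: "('m, 'e) charts \<Rightarrow> 'm \<Rightarrow> 'e \<Rightarrow> 'm" where
  "chart_inv c p = inv_into (chart_dom c p) (chart_map c p)"

definition smooth_manifold :: "('m::t2_space, 'e::real_normed_vector) charts \<Rightarrow> bool" where
  "smooth_manifold c \<longleftrightarrow>
     second_countable (euclidean :: 'm topology) \<and>
     (\<exists>B::'e set. finite B \<and> span B = UNIV) \<and>
     (\<forall>p. p \<in> chart_dom c p \<and> open (chart_dom c p) \<and> open (chart_map c p ` chart_dom c p) \<and>
        homeomorphism (chart_dom c p) (chart_map c p ` chart_dom c p)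
          (chart_map c p) (chart_inv c p)) \<and>
     (\<forall>p q. smooth_on (chart_map c p ` (chart_dom c p \<inter> chart_dom c q))
        (chart_map c q \<circ> chart_inv c p))"

definition smooth_map ::
  "('m::topological_space, 'e::real_normed_vector) charts \<Rightarrow>
   ('n::topological_space, 'f::real_normed_vector) charts \<Rightarrow> ('m \<Rightarrow> 'n) \<Rightarrow> bool" where
  "smooth_map c d f \<longleftrightarrow>
     continuous_on UNIV f \<and>
     (\<forall>p q. smooth_on (chart_map c p ` (chart_dom c p \<inter> f -` chart_dom d q))
        (chart_map d q \<circ> f \<circ> chart_inv c p))"

definition prod_charts :: "('m, 'e) charts \<Rightarrow> ('n, 'f) charts \<Rightarrow> ('m \<times> 'n, 'e \<times> 'f) charts" where
  "prod_charts c d =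
     (\<lambda>(p, q). (chart_dom c p \<times> chart_dom d q, map_prod (chart_map c p) (chart_map d q)))"

definition vec_charts :: "('e, 'e) charts" where
  "vec_charts = (\<lambda>_. (UNIV, id))"

text \<open>
  The tangent map \<open>T\<^sub>p f : T\<^sub>p M \<rightarrow> T\<^bsub>f p\<^esub> N\<close>, in the charts at \<open>p\<close> and at \<open>f p\<close>.
\<close>

definition tangent_map ::
  "('m, 'e::real_normed_vector) charts \<Rightarrow> ('n, 'f::real_normed_vector) charts \<Rightarrow>
   ('m \<Rightarrow> 'n) \<Rightarrow> 'm \<Rightarrow> 'e \<Rightarrow> 'f" where
  "tangent_map c d f p =
     frechet_derivative (chart_map d (f p) \<circ> f \<circ> chart_inv c p) (at (chart_map c p p))"

definition differential ::
  "('m, 'e::real_normed_vector) charts \<Rightarrow> ('m \<Rightarrow> real) \<Rightarrow> 'm \<Rightarrow> 'e \<Rightarrow>\<^sub>L real" where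
  "differential c f p = Blinfun (tangent_map c vec_charts f p)"

text \<open>
  A vector field is a map \<open>X\<close> with \<open>X q \<in> T\<^sub>q M\<close>. Its representative in the chart at \<open>p\<close> is
  \<open>u \<mapsto> T\<^sub>q\<phi>\<^sub>p (X q)\<close> with \<open>q = \<phi>\<^sub>p\<inverse> u\<close>; the bracket is the commutator of derivations,
  \<open>[X, Y] = DY \<cdot> X - DX \<cdot> Y\<close>.
\<close>

definition vf_local ::
  "('m, 'e::real_normed_vector) charts \<Rightarrow> ('m \<Rightarrow> 'e) \<Rightarrow> 'm \<Rightarrow> 'e \<Rightarrow> 'e" where
  "vf_local c X p u =
     tangent_map c vec_charts (chart_map c p) (chart_inv c p u) (X (chart_inv c p u))"

definition vf_bracket ::
  "('m, 'e::real_normed_vector) charts \<Rightarrow> ('m \<Rightarrow> 'e) \<Rightarrow> ('m \<Rightarrow> 'e) \<Rightarrow> 'm \<Rightarrow> 'e" where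
  "vf_bracket c X Y p =
     frechet_derivative (vf_local c Y p) (at (chart_map c p p)) (X p) -
     frechet_derivative (vf_local c X p) (at (chart_map c p p)) (Y p)"


section \<open>Lie groups\<close>

record ('a, 'e) lie_group_data = "'a monoid" +
  charts :: "('a, 'e) charts"

locale lie_group = group G
  for G :: "('g::t2_space, 'e::real_normed_vector) lie_group_data" (structure) +
  assumes carrier_UNIV: "carrier G = UNIV"
    and manifold: "smooth_manifold (charts G)"
    and smooth_mult:
      "smooth_map (prod_charts (charts G) (charts G)) (charts G) (\<lambda>(x, y). x \<otimes> y)"
    and smooth_inv: "smooth_map (charts G) (charts G) (\<lambda>x. inv x)"

text \<open>
  The Lie algebra is the tangent space at the identity, with the bracket of left invariant
  vector fields.
\<close>

definition tangent_left ::
  "('g, 'e::real_normed_vector) lie_group_data \<Rightarrow> 'g \<Rightarrow> 'e \<Rightarrow> 'e" where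
  "tangent_left G x = tangent_map (charts G) (charts G) (\<lambda>y. x \<otimes>\<^bsub>G\<^esub> y) \<one>\<^bsub>G\<^esub>"

definition left_invariant_field ::
  "('g, 'e::real_normed_vector) lie_group_data \<Rightarrow> 'e \<Rightarrow> 'g \<Rightarrow> 'e" where
  "left_invariant_field G \<xi> = (\<lambda>x. tangent_left G x \<xi>)"

definition ad :: "('g, 'e::real_normed_vector) lie_group_data \<Rightarrow> 'e \<Rightarrow> 'e \<Rightarrow> 'e" where
  "ad G \<xi> \<eta> =
     vf_bracket (charts G) (left_invariant_field G \<xi>) (left_invariant_field G \<eta>) \<one>\<^bsub>G\<^esub>"

definition Ad :: "('g, 'e::real_normed_vector) lie_group_data \<Rightarrow> 'g \<Rightarrow> 'e \<Rightarrow> 'e" where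
  "Ad G x = tangent_map (charts G) (charts G) (\<lambda>y. x \<otimes>\<^bsub>G\<^esub> y \<otimes>\<^bsub>G\<^esub> inv\<^bsub>G\<^esub> x) \<one>\<^bsub>G\<^esub>"

definition coad ::
  "('g, 'e::real_normed_vector) lie_group_data \<Rightarrow> 'e \<Rightarrow> ('e \<Rightarrow>\<^sub>L real) \<Rightarrow> ('e \<Rightarrow>\<^sub>L real)" where
  "coad G \<xi> \<mu> = Blinfun (\<lambda>\<zeta>. - blinfun_apply \<mu> (ad G \<xi> \<zeta>))"

definition cotangent_left ::
  "('g, 'e::real_normed_vector) lie_group_data \<Rightarrow> 'g \<Rightarrow> ('e \<Rightarrow>\<^sub>L real) \<Rightarrow> ('e \<Rightarrow>\<^sub>L real)" where
  "cotangent_left G x \<alpha> = Blinfun (\<lambda>\<zeta>. blinfun_apply \<alpha> (tangent_left G x \<zeta>))"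

definition additive_group :: "('e::real_normed_vector, 'e) lie_group_data" where
  "additive_group = \<lparr>carrier = UNIV, mult = (+), one = 0, charts = vec_charts\<rparr>"


section \<open>Trivialized Euler-Lagrange equations\<close>

text \<open>
  A Lagrangian on \<open>TK\<close> is a function on \<open>K \<times> \<kk>\<close>, by left trivialization. The equation is
  stated at time \<open>t\<close> along a curve \<open>(k, \<xi>)\<close> in \<open>K \<times> \<kk>\<close>, and includes the existence of the time
  derivative.
\<close>

definition smooth_lagrangian ::
  "('k::topological_space, 'e::real_normed_vector) lie_group_data \<Rightarrow> ('k \<Rightarrow> 'e \<Rightarrow> real) \<Rightarrow> bool" where
  "smooth_lagrangian K L \<longleftrightarrow>
     smooth_map (prod_charts (charts K) vec_charts) vec_charts (\<lambda>(k, \<xi>). L k \<xi>)"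

definition partial_group ::
  "('k, 'e::real_normed_vector) lie_group_data \<Rightarrow> ('k \<Rightarrow> 'e \<Rightarrow> real) \<Rightarrow> 'k \<Rightarrow> 'e \<Rightarrow> 'e \<Rightarrow>\<^sub>L real" where
  "partial_group K L k \<xi> = differential (charts K) (\<lambda>x. L x \<xi>) k"

definition partial_algebra ::
  "('k \<Rightarrow> 'e::real_normed_vector \<Rightarrow> real) \<Rightarrow> 'k \<Rightarrow> 'e \<Rightarrow> 'e \<Rightarrow>\<^sub>L real" where
  "partial_algebra L k \<xi> = differential vec_charts (\<lambda>\<zeta>. L k \<zeta>) \<xi>"

definition euler_lagrange_at ::
  "('k, 'e::real_normed_vector) lie_group_data \<Rightarrow> ('k \<Rightarrow> 'e \<Rightarrow> real) \<Rightarrow>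
   (real \<Rightarrow> 'k) \<Rightarrow> (real \<Rightarrow> 'e) \<Rightarrow> real \<Rightarrow> bool" where
  "euler_lagrange_at K L k \<xi> t \<longleftrightarrow>
     ((\<lambda>s. partial_algebra L (k s) (\<xi> s)) has_vector_derivative
        (cotangent_left K (k t) (partial_group K L (k t) (\<xi> t))
         - coad K (\<xi> t) (partial_algebra L (k t) (\<xi> t)))) (at t)"


section \<open>The second order tangent group\<close>

text \<open>
  The left trivialization \<open>G \<times> \<gg> \<times> \<gg>\<close> of the group of second order jets at \<open>0\<close> of curves in \<open>G\<close>,
  the jet of \<open>p\<close> corresponding to \<open>(p 0, (\<delta>p) 0, (\<delta>p)' 0)\<close> where \<open>\<delta>p = p\<inverse> p'\<close>. It is the
  extension of \<open>TG = G \<ltimes> \<gg>\<close> by \<open>\<gg>\<close> with cocycle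
  \<open>\<phi>((x, \<xi>\<^sub>1), (y, \<zeta>\<^sub>1)) = - ad \<zeta>\<^sub>1 (Ad y\<inverse> \<xi>\<^sub>1)\<close>.
\<close>

definition second_tangent_group ::
  "('g, 'e::real_normed_vector) lie_group_data \<Rightarrow>
   ('g \<times> 'e \<times> 'e, 'e \<times> 'e \<times> 'e) lie_group_data" where
  "second_tangent_group G =
     \<lparr>carrier = carrier G \<times> UNIV \<times> UNIV,
      mult = (\<lambda>(x, \<xi>1, \<xi>2) (y, \<zeta>1, \<zeta>2).
        (x \<otimes>\<^bsub>G\<^esub> y,
         \<zeta>1 + Ad G (inv\<^bsub>G\<^esub> y) \<xi>1,
         \<zeta>2 + Ad G (inv\<^bsub>G\<^esub> y) \<xi>2 - ad G \<zeta>1 (Ad G (inv\<^bsub>G\<^esub> y) \<xi>1))),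
      one = (\<one>\<^bsub>G\<^esub>, 0, 0),
      charts = prod_charts (charts G) (prod_charts vec_charts vec_charts)\<rparr>"

fun partial_g ::
  "('g, 'e::real_normed_vector) lie_group_data \<Rightarrow>
   ('g \<times> 'e \<times> 'e \<Rightarrow> 'e \<times> 'e \<times> 'e \<Rightarrow> real) \<Rightarrow> 'g \<times> 'e \<times> 'e \<Rightarrow> 'e \<times> 'e \<times> 'e \<Rightarrow> 'e \<Rightarrow>\<^sub>L real" where
  "partial_g G L (g, \<xi>1, \<xi>2) \<eta> = differential (charts G) (\<lambda>x. L (x, \<xi>1, \<xi>2) \<eta>) g"

fun partial_xi1 ::
  "('g \<times> 'e \<times> 'e \<Rightarrow> 'e \<times> 'e \<times> 'e \<Rightarrow> real) \<Rightarrow> 'g \<times> 'e \<times> 'e \<Rightarrow> 'e \<times> 'e \<times> 'e \<Rightarrow>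
   'e::real_normed_vector \<Rightarrow>\<^sub>L real" where
  "partial_xi1 L (g, \<xi>1, \<xi>2) \<eta> = differential vec_charts (\<lambda>v. L (g, v, \<xi>2) \<eta>) \<xi>1"

fun partial_xi2 ::
  "('g \<times> 'e \<times> 'e \<Rightarrow> 'e \<times> 'e \<times> 'e \<Rightarrow> real) \<Rightarrow> 'g \<times> 'e \<times> 'e \<Rightarrow> 'e \<times> 'e \<times> 'e \<Rightarrow>
   'e::real_normed_vector \<Rightarrow>\<^sub>L real" where
  "partial_xi2 L (g, \<xi>1, \<xi>2) \<eta> = differential vec_charts (\<lambda>v. L (g, \<xi>1, v) \<eta>) \<xi>2"

fun partial_eta0 ::
  "('g \<times> 'e \<times> 'e \<Rightarrow> 'e \<times> 'e \<times> 'e \<Rightarrow> real) \<Rightarrow> 'g \<times> 'e \<times> 'e \<Rightarrow> 'e \<times> 'e \<times> 'e \<Rightarrow>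
   'e::real_normed_vector \<Rightarrow>\<^sub>L real" where
  "partial_eta0 L k (\<eta>0, \<eta>1, \<eta>2) = differential vec_charts (\<lambda>v. L k (v, \<eta>1, \<eta>2)) \<eta>0"

fun partial_eta1 ::
  "('g \<times> 'e \<times> 'e \<Rightarrow> 'e \<times> 'e \<times> 'e \<Rightarrow> real) \<Rightarrow> 'g \<times> 'e \<times> 'e \<Rightarrow> 'e \<times> 'e \<times> 'e \<Rightarrow>
   'e::real_normed_vector \<Rightarrow>\<^sub>L real" where
  "partial_eta1 L k (\<eta>0, \<eta>1, \<eta>2) = differential vec_charts (\<lambda>v. L k (\<eta>0, v, \<eta>2)) \<eta>1"

fun partial_eta2 ::
  "('g \<times> 'e \<times> 'e \<Rightarrow> 'e \<times> 'e \<times> 'e \<Rightarrow> real) \<Rightarrow> 'g \<times> 'e \<times> 'e \<Rightarrow> 'e \<times> 'e \<times> 'e \<Rightarrow>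
   'e::real_normed_vector \<Rightarrow>\<^sub>L real" where
  "partial_eta2 L k (\<eta>0, \<eta>1, \<eta>2) = differential vec_charts (\<lambda>v. L k (\<eta>0, \<eta>1, v)) \<eta>2"

end

theory Submission
  imports Defs
begin

text \<open>
  The Euler-Lagrange equation on a Lie group \<open>K\<close> is one equation in the dual of the Lie algebra of
  \<open>K\<close>. For \<open>K = T\<^sup>2G\<close> this dual splits into three copies of \<open>\<gg>\<^sup>*\<close>, so everything comes down to
  the derivative of left translation and the bracket of \<open>T\<^sup>2G\<close> in terms of \<open>G\<close>,
  \<open>TL\<^bsub>(x, a, b)\<^esub> (h\<^sub>0, h\<^sub>1, h\<^sub>2) = (TL\<^sub>x h\<^sub>0, h\<^sub>1 - [h\<^sub>0, a], h\<^sub>2 - [h\<^sub>0, b] - [h\<^sub>1, a])\<close>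
  (\<open>tangent_left_T2\<close>) and
  \<open>[\<eta>, \<zeta>] = ([\<eta>\<^sub>0, \<zeta>\<^sub>0], [\<eta>\<^sub>0, \<zeta>\<^sub>1] + [\<eta>\<^sub>1, \<zeta>\<^sub>0], [\<eta>\<^sub>0, \<zeta>\<^sub>2] + [\<eta>\<^sub>2, \<zeta>\<^sub>0] + 2 [\<eta>\<^sub>1, \<zeta>\<^sub>1])\<close> (\<open>ad_T2\<close>).
  Transposing both maps and reading off the coefficients of \<open>h\<^sub>0\<close>, \<open>h\<^sub>1\<close>, \<open>h\<^sub>2\<close> gives the three
  equations. Since the product of \<open>T\<^sup>2G\<close> involves \<open>Ad y\<inverse>\<close>, the first formula rests on the fact that the
  derivative of \<open>y \<mapsto> Ad y\<inverse> \<zeta>\<close> at the identity is \<open>h \<mapsto> - [h, \<zeta>]\<close>; the second follows by differentiating the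
  left invariant fields that the first one describes, and the factor \<open>2\<close> arises because the term
  \<open>[h\<^sub>1, a]\<close> contributes once to each half of the commutator of two fields.

  The analytic heart is therefore \<open>Ad_inv_has_derivative\<close>. Let \<open>m\<close> be the multiplication in a chart at
  the identity, with \<open>m (u, o) = u = m (o, u)\<close> for the image \<open>o\<close> of the identity. The left invariant
  field of \<open>\<xi>\<close> reads \<open>u \<mapsto> Dm(u, o) (0, \<xi>)\<close>, whence
  \<open>[\<xi>, \<eta>] = D\<^sup>2m ((0, \<eta>), (\<xi>, 0)) - D\<^sup>2m ((0, \<xi>), (\<eta>, 0))\<close>. With the inversion \<open>i\<close> in the chart, where
  \<open>Di(o) = - id\<close>, one has \<open>Ad y\<inverse> \<zeta> = Dm(i u, u) (Dm(i u, o) (0, \<zeta>), 0)\<close> if \<open>y\<close> has the coordinate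
  \<open>u\<close>, and the derivative of this at \<open>o\<close> is \<open>D\<^sup>2m ((\<zeta>, 0), (- h, h)) + D\<^sup>2m ((0, \<zeta>), (- h, 0))\<close>. The
  part of \<open>D\<^sup>2m\<close> that is pure in the first factor vanishes, and the symmetry of \<open>D\<^sup>2m\<close>
  (\<open>second_derivative_symmetric\<close>) identifies the rest with \<open>- [h, \<zeta>]\<close>.

  Finite dimension enters through \<open>has_derivative_linear_family_apply\<close>: a family of linear maps that
  is differentiable at each vector can be differentiated together with its argument.
\<close>

section \<open>Linear families on finite-dimensional spaces\<close>

text \<open>
  The coordinates with respect to a basis \<open>C\<close> are bounded because the norm has a positive minimum on
  the compact set of combinations of \<open>C\<close> whose coefficients have absolute sum \<open>1\<close>. Compactness is taken in the
  product topology of the coefficient functions, extended by \<open>0\<close> outside of \<open>C\<close>.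
\<close>

lemma finite_dimensional_coordinates:
  fixes B :: "'a::real_normed_vector set"
  assumes "finite B" and "span B = UNIV"
  obtains C :: "'a set" and c :: "'a \<Rightarrow> 'a \<Rightarrow> real"
  where "finite C" and "\<And>b. bounded_linear (c b)" and "\<And>x. x = (\<Sum>b\<in>C. c b x *\<^sub>R b)"
proof -
  obtain C where C: "C \<subseteq> B" "independent C" "B \<subseteq> span C"
    using maximal_independent_subset[of B] by blast
  then have spanC: "span C = UNIV"
    using span_mono[OF C(3)] assms(2) by (simp add: span_span top.extremum_uniqueI)
  have fin: "finite C" using C(1) assms(1) finite_subset by blast
  define c where "c b x = representation C x b" for b x
  have sum: "x = (\<Sum>b\<in>C. c b x *\<^sub>R b)" for x
    unfolding c_def using real_vector.sum_representation_eq[OF C(2) _ fin order_refl] spanC by auto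
  have lin: "linear (c b)" for b
    unfolding c_def using C(2) spanC
    by (intro linearI) (simp_all add: real_vector.representation_add real_vector.representation_scale)
  define S where "S = {d :: 'a \<Rightarrow> real. (\<forall>b. d b \<in> (if b \<in> C then {-1..1} else {0}))}
     \<inter> {d. (\<Sum>b\<in>C. \<bar>d b\<bar>) = 1}"
  have cS: "compact S"
  proof -
    have "compact (Pi\<^sub>E (UNIV::'a set) (\<lambda>b. if b \<in> C then {-1..1::real} else {0}))"
    proof -
      have "compactin (product_topology (\<lambda>_. euclidean) UNIV)
          (Pi\<^sub>E (UNIV::'a set) (\<lambda>b. if b \<in> C then {-1..1::real} else {0}))"
        unfolding compactin_PiE by simp
      then show ?thesis
        unfolding euclidean_product_topology by simp
    qed
    moreover have "closed {d :: 'a \<Rightarrow> real. (\<Sum>b\<in>C. \<bar>d b\<bar>) = 1}"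
      by (intro closed_Collect_eq continuous_intros) auto
    ultimately have "compact (Pi\<^sub>E (UNIV::'a set) (\<lambda>b. if b \<in> C then {-1..1::real} else {0}) \<inter> {d. (\<Sum>b\<in>C. \<bar>d b\<bar>) = 1})"
      by (rule compact_Int_closed)
    then show ?thesis by (simp add: S_def PiE_UNIV_domain Pi_def)
  qed
  obtain m where m: "m > 0" "\<And>d. d \<in> S \<Longrightarrow> m \<le> norm (\<Sum>b\<in>C. d b *\<^sub>R b)"
  proof (cases "S = {}")
    case False
    have "continuous_on S (\<lambda>d. norm (\<Sum>b\<in>C. d b *\<^sub>R b))"
      by (intro continuous_intros continuous_on_subset[OF continuous_on_product_coordinates]) auto
    then obtain d0 where d0: "d0 \<in> S" "\<And>d. d \<in> S \<Longrightarrow> norm (\<Sum>b\<in>C. d0 b *\<^sub>R b) \<le> norm (\<Sum>b\<in>C. d b *\<^sub>R b)"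
      using continuous_attains_inf[OF cS False] by blast
    have "(\<Sum>b\<in>C. d0 b *\<^sub>R b) \<noteq> 0"
    proof
      assume "(\<Sum>b\<in>C. d0 b *\<^sub>R b) = 0"
      then have "\<forall>b\<in>C. d0 b = 0"
        using real_vector.independentD[OF C(2) fin order_refl] by blast
      then show False using d0(1) by (simp add: S_def)
    qed
    then show ?thesis using that[of "norm (\<Sum>b\<in>C. d0 b *\<^sub>R b)"] d0(2) by simp
  qed (use that[of 1] in auto)
  have bound: "m * (\<Sum>b\<in>C. \<bar>c b x\<bar>) \<le> norm x" for x
  proof (cases "(\<Sum>b\<in>C. \<bar>c b x\<bar>) = 0")
    case False
    define s where "s = (\<Sum>b\<in>C. \<bar>c b x\<bar>)"
    have s: "s > 0" using False unfolding s_def by (simp add: sum_nonneg order_less_le)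
    define d where "d b = (if b \<in> C then c b x / s else 0)" for b
    have le: "\<bar>c b x\<bar> \<le> s" if "b \<in> C" for b
      unfolding s_def using that fin by (intro member_le_sum) auto
    have "(\<Sum>b\<in>C. \<bar>d b\<bar>) = 1"
      using s by (simp add: d_def sum_divide_distrib[symmetric] s_def[symmetric])
    moreover have "d b \<in> {-1..1}" if "b \<in> C" for b
      using le[OF that] s that by (auto simp: d_def field_simps abs_le_iff)
    ultimately have "d \<in> S" by (auto simp: S_def d_def)
    then have "m \<le> norm (\<Sum>b\<in>C. d b *\<^sub>R b)" by (rule m)
    also have "(\<Sum>b\<in>C. d b *\<^sub>R b) = (1 / s) *\<^sub>R (\<Sum>b\<in>C. c b x *\<^sub>R b)"
      by (simp add: d_def scaleR_sum_right)
    also have "norm \<dots> = norm x / s" using s sum[of x] by simp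
    finally show ?thesis using s by (simp add: s_def[symmetric] field_simps)
  qed simp
  have "bounded_linear (c b)" for b
  proof (cases "b \<in> C")
    case True
    have "norm (c b x) \<le> norm x * (1 / m)" for x
    proof -
      have "\<bar>c b x\<bar> \<le> (\<Sum>b\<in>C. \<bar>c b x\<bar>)"
        using True fin by (intro member_le_sum) auto
      then have "m * \<bar>c b x\<bar> \<le> norm x" using bound[of x] m(1)
        by (meson mult_left_mono order_trans less_imp_le)
      then show ?thesis using m(1) by (simp add: field_simps)
    qed
    then show ?thesis using lin[of b]
      by (intro bounded_linear_intro[of _ "1/m"]) (auto simp: linear_add linear_scale)
  next
    case False
    then have "c b = (\<lambda>_. 0)"
      using representation_ne_zero by (auto simp: c_def fun_eq_iff)
    then show ?thesis by simp
  qed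
  then show ?thesis using that fin sum by blast
qed

text \<open>
  A product rule that does not presuppose that \<open>F\<close> is differentiable in the operator norm: in coordinates,
  \<open>F p (w p)\<close> is a finite sum of products of coefficients of \<open>w p\<close> with values of \<open>F p\<close> on basis vectors.
\<close>

lemma has_derivative_linear_family_apply:
  fixes F :: "'p::real_normed_vector \<Rightarrow> 'a::real_normed_vector \<Rightarrow> 'b::real_normed_vector"
  assumes "finite (B :: 'a set)" and "span B = UNIV"
    and lin: "\<forall>\<^sub>F p in nhds p0. linear (F p)"
    and F: "\<And>v. ((\<lambda>p. F p v) has_derivative (\<lambda>h. F' h v)) (at p0)"
    and w: "(w has_derivative w') (at p0)"
  shows "((\<lambda>p. F p (w p)) has_derivative (\<lambda>h. F' h (w p0) + F p0 (w' h))) (at p0)"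
proof -
  obtain C c where C: "finite C" "\<And>b. bounded_linear (c b)"
      and sum: "\<And>x::'a. x = (\<Sum>b\<in>C. c b x *\<^sub>R b)"
    using finite_dimensional_coordinates[OF assms(1,2)] by metis
  have lin0: "linear (F p0)" using lin by (rule eventually_nhds_x_imp_x)
  have expand: "f v = (\<Sum>b\<in>C. c b v *\<^sub>R f b)" if "linear f" for f :: "'a \<Rightarrow> 'b" and v
    using arg_cong[OF sum[of v], of f] by (simp only: linear_sum[OF that] linear_scale[OF that])
  have lin_at: "\<forall>\<^sub>F p in at p0. linear (F p)"
    using lin eventually_nhds_conv_at by blast
  have ders: "((\<lambda>p. F p (u p)) has_derivative
      (\<lambda>h. \<Sum>b\<in>C. c b (u p0) *\<^sub>R F' h b + c b (u' h) *\<^sub>R F p0 b)) (at p0)"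
    if u: "(u has_derivative u') (at p0)" for u u'
  proof -
    have "((\<lambda>p. \<Sum>b\<in>C. c b (u p) *\<^sub>R F p b) has_derivative
      (\<lambda>h. \<Sum>b\<in>C. c b (u p0) *\<^sub>R F' h b + c b (u' h) *\<^sub>R F p0 b)) (at p0)"
      by (intro has_derivative_sum has_derivative_scaleR F bounded_linear.has_derivative[OF C(2)] u)
    then show ?thesis
    proof (rule has_derivative_transform_eventually)
      show "\<forall>\<^sub>F p in at p0. (\<Sum>b\<in>C. c b (u p) *\<^sub>R F p b) = F p (u p)"
        using lin_at by eventually_elim (rule expand[symmetric])
      show "(\<Sum>b\<in>C. c b (u p0) *\<^sub>R F p0 b) = F p0 (u p0)"
        by (rule expand[OF lin0, symmetric])
    qed simp
  qed
  have zero: "c b 0 = 0" for b using C(2) by (simp add: linear_simps)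
  \<comment> \<open>The rule just obtained for a constant \<open>u\<close> shows that \<open>F' h\<close> is linear.\<close>
  have F': "(\<Sum>b\<in>C. c b v *\<^sub>R F' h b) = F' h v" for h v
    using fun_cong[OF has_derivative_unique[OF F ders[of "\<lambda>_. v" "\<lambda>_. 0"]], of h] by (simp add: zero)
  show ?thesis
    using ders[OF w] by (simp only: sum.distrib expand[OF lin0, symmetric] F')
qed

section \<open>Symmetry of second derivatives\<close>

text \<open>
  The second difference over the parallelogram with sides \<open>h v\<close> and \<open>h w\<close> is \<open>h\<^sup>2\<close> times the mixed
  derivative, up to \<open>o(h\<^sup>2)\<close>. The mean value inequality, unlike the mean value theorem, holds for vector
  values; it is used in the direction \<open>w\<close> and then in the direction \<open>v\<close>.
\<close>

lemma second_difference_bound: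
  fixes f :: "'a::real_normed_vector \<Rightarrow> 'b::real_normed_vector"
  assumes "open S" and "x \<in> S" and f: "Ck_on 2 S f" and "0 < e"
  shows "\<exists>d>0. \<forall>h. 0 < h \<and> h < d \<longrightarrow>
    norm (f (x + h *\<^sub>R v + h *\<^sub>R w) - f (x + h *\<^sub>R v) - f (x + h *\<^sub>R w) + f x
      - (h * h) *\<^sub>R frechet_derivative (\<lambda>y. frechet_derivative f (at y) v) (at x) w) \<le> e * (h * h)"
proof -
  define A where "A y = frechet_derivative (\<lambda>y. frechet_derivative f (at y) v) (at y) w" for y
  have f1: "(f has_derivative frechet_derivative f (at y)) (at y)" if "y \<in> S" for y
    using f that by (simp add: numeral_2_eq_2 frechet_derivative_works)
  have f2: "((\<lambda>y. frechet_derivative f (at y) v) has_derivative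
      frechet_derivative (\<lambda>y. frechet_derivative f (at y) v) (at y)) (at y)" if "y \<in> S" for y
    using f that by (simp add: numeral_2_eq_2 frechet_derivative_works)
  have "continuous_on S A"
    using f by (simp add: numeral_2_eq_2 A_def[abs_def])
  then obtain r where r: "r > 0" "\<And>y. dist y x < r \<Longrightarrow> y \<in> S \<and> norm (A y - A x) \<le> e"
  proof -
    obtain r1 where "r1 > 0" "\<And>y. y \<in> S \<Longrightarrow> dist y x < r1 \<Longrightarrow> dist (A y) (A x) < e"
      using \<open>continuous_on S A\<close> assms(2,4) unfolding continuous_on_iff by blast
    moreover obtain r2 where "r2 > 0" "ball x r2 \<subseteq> S"
      using assms(1,2) openE by blast
    ultimately show ?thesis
      using that[of "min r1 r2"]
      by (auto simp: subset_iff dist_commute dist_norm[of "A _"] less_imp_le)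
  qed
  \<comment> \<open>This choice keeps the whole parallelogram with sides \<open>h v\<close> and \<open>h w\<close> in the ball of radius \<open>r\<close>.\<close>
  define d where "d = r / (norm v + norm w + 1)"
  have nn: "norm v + norm w + 1 > 0" by (smt (verit) norm_ge_zero)
  have "d > 0" using r nn by (simp add: d_def)
  moreover have "norm (f (x + h *\<^sub>R v + h *\<^sub>R w) - f (x + h *\<^sub>R v) - f (x + h *\<^sub>R w) + f x
      - (h * h) *\<^sub>R A x) \<le> e * (h * h)" if h: "0 < h" "h < d" for h
  proof -
    have near: "dist (x + s *\<^sub>R v + t *\<^sub>R w) x < r" if "s \<in> {0..h}" "t \<in> {0..h}" for s t
    proof -
      have "dist (x + s *\<^sub>R v + t *\<^sub>R w) x \<le> s * norm v + t * norm w"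
        using norm_triangle_ineq[of "s *\<^sub>R v" "t *\<^sub>R w"] that by (simp add: dist_norm algebra_simps)
      also have "\<dots> \<le> h * norm v + h * norm w"
        using that by (intro add_mono mult_right_mono) auto
      also have "\<dots> \<le> h * (norm v + norm w + 1)" using h by (simp add: algebra_simps)
      also have "\<dots> < r" using h(2) nn by (simp add: d_def field_simps)
      finally show ?thesis .
    qed
    \<comment> \<open>The first derivatives along \<open>v\<close> on the two sides of the parallelogram that are parallel to \<open>v\<close> are compared first; the outer estimate integrates this along \<open>v\<close>.\<close>
    have inner: "norm (frechet_derivative f (at (x + s *\<^sub>R v + h *\<^sub>R w)) v
        - frechet_derivative f (at (x + s *\<^sub>R v)) v - h *\<^sub>R A x) \<le> e * h" if s: "s \<in> {0..h}" for s
    proof -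
      have "norm ((frechet_derivative f (at (x + s *\<^sub>R v + h *\<^sub>R w)) v - h *\<^sub>R A x)
          - (frechet_derivative f (at (x + s *\<^sub>R v + 0 *\<^sub>R w)) v - 0 *\<^sub>R A x)) \<le> e * norm (h - 0)"
      proof (rule differentiable_bound[of "{0..h}" _ "\<lambda>t k. k *\<^sub>R (A (x + s *\<^sub>R v + t *\<^sub>R w) - A x)"])
        fix t assume t: "t \<in> {0..h}"
        let ?y = "x + s *\<^sub>R v + t *\<^sub>R w"
        have y: "?y \<in> S" "norm (A ?y - A x) \<le> e" using r near[OF s t] by auto
        have "((\<lambda>t. x + s *\<^sub>R v + t *\<^sub>R w) has_derivative (\<lambda>k. k *\<^sub>R w)) (at t within {0..h})"
          by (auto intro!: derivative_eq_intros)
        from has_derivative_compose[OF this f2[OF y(1)]]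
        have "((\<lambda>t. frechet_derivative f (at (x + s *\<^sub>R v + t *\<^sub>R w)) v) has_derivative
            (\<lambda>k. k *\<^sub>R A ?y)) (at t within {0..h})"
          using linear_frechet_derivative[OF differentiableI[OF f2[OF y(1)]]]
          by (simp add: A_def linear_scale)
        then show "((\<lambda>t. frechet_derivative f (at (x + s *\<^sub>R v + t *\<^sub>R w)) v - t *\<^sub>R A x) has_derivative
            (\<lambda>k. k *\<^sub>R (A ?y - A x))) (at t within {0..h})"
          by (auto intro!: derivative_eq_intros simp: algebra_simps)
        show "onorm (\<lambda>k. k *\<^sub>R (A ?y - A x)) \<le> e"
          using y(2) by (intro onorm_le) (simp add: mult.commute[of e] mult_left_mono)
      qed (use h in auto)
      then show ?thesis using h by (simp add: algebra_simps)
    qed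
    have "norm ((f (x + h *\<^sub>R v + h *\<^sub>R w) - f (x + h *\<^sub>R v) - (h * h) *\<^sub>R A x)
          - (f (x + 0 *\<^sub>R v + h *\<^sub>R w) - f (x + 0 *\<^sub>R v) - (0 * h) *\<^sub>R A x)) \<le> (e * h) * norm (h - 0)"
    proof (rule differentiable_bound[of "{0..h}" "\<lambda>s. f (x + s *\<^sub>R v + h *\<^sub>R w) - f (x + s *\<^sub>R v) - (s * h) *\<^sub>R A x"
          "\<lambda>s k. k *\<^sub>R (frechet_derivative f (at (x + s *\<^sub>R v + h *\<^sub>R w)) v
        - frechet_derivative f (at (x + s *\<^sub>R v)) v - h *\<^sub>R A x)"])
      fix s assume s: "s \<in> {0..h}"
      have y: "x + s *\<^sub>R v + t *\<^sub>R w \<in> S" if "t \<in> {0..h}" for t using r near[OF s that] by auto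
      have d: "((\<lambda>s. f (x + s *\<^sub>R v + t *\<^sub>R w)) has_derivative
          (\<lambda>k. k *\<^sub>R frechet_derivative f (at (x + s *\<^sub>R v + t *\<^sub>R w)) v)) (at s within {0..h})"
        if t: "t \<in> {0..h}" for t
      proof -
        have "((\<lambda>s. x + s *\<^sub>R v + t *\<^sub>R w) has_derivative (\<lambda>k. k *\<^sub>R v)) (at s within {0..h})"
          by (auto intro!: derivative_eq_intros)
        from has_derivative_compose[OF this f1[OF y[OF t]]]
        show ?thesis
          using linear_frechet_derivative[OF differentiableI[OF f1[OF y[OF t]]]]
          by (simp add: linear_scale)
      qed
      show "((\<lambda>s. f (x + s *\<^sub>R v + h *\<^sub>R w) - f (x + s *\<^sub>R v) - (s * h) *\<^sub>R A x) has_derivative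
          (\<lambda>k. k *\<^sub>R (frechet_derivative f (at (x + s *\<^sub>R v + h *\<^sub>R w)) v
        - frechet_derivative f (at (x + s *\<^sub>R v)) v - h *\<^sub>R A x))) (at s within {0..h})"
        using d[of h] d[of 0] h
        by (auto intro!: derivative_eq_intros simp: algebra_simps)
      show "onorm (\<lambda>k. k *\<^sub>R (frechet_derivative f (at (x + s *\<^sub>R v + h *\<^sub>R w)) v
        - frechet_derivative f (at (x + s *\<^sub>R v)) v - h *\<^sub>R A x)) \<le> e * h"
        using inner[OF s] by (intro onorm_le) (simp add: mult.commute[of "e * h"] mult_left_mono)
    qed (use h in auto)
    then show ?thesis using h by (simp add: algebra_simps)
  qed
  ultimately show ?thesis unfolding A_def by blast
qed

text \<open>
  The second difference is symmetric in \<open>v\<close> and \<open>w\<close>, so both mixed derivatives approximate it up to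
  \<open>e h\<^sup>2\<close> for every \<open>e\<close>.
\<close>

lemma second_derivative_symmetric:
  fixes f :: "'a::real_normed_vector \<Rightarrow> 'b::real_normed_vector"
  assumes "open S" and "x \<in> S" and "Ck_on 2 S f"
  shows "frechet_derivative (\<lambda>y. frechet_derivative f (at y) v) (at x) w =
    frechet_derivative (\<lambda>y. frechet_derivative f (at y) w) (at x) v" (is "?A = ?B")
proof -
  have "norm (?A - ?B) \<le> e" if "e > 0" for e
  proof -
    let ?D = "\<lambda>h. f (x + h *\<^sub>R v + h *\<^sub>R w) - f (x + h *\<^sub>R v) - f (x + h *\<^sub>R w) + f x"
    obtain d where d: "d > 0" "\<And>h. 0 < h \<Longrightarrow> h < d \<Longrightarrow> norm (?D h - (h * h) *\<^sub>R ?A) \<le> e / 2 * (h * h)"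
      using second_difference_bound[OF assms, of "e / 2" v w] \<open>e > 0\<close> by auto
    obtain d' where d': "d' > 0" "\<And>h. 0 < h \<Longrightarrow> h < d' \<Longrightarrow> norm (?D h - (h * h) *\<^sub>R ?B) \<le> e / 2 * (h * h)"
      using second_difference_bound[OF assms, of "e / 2" w v] \<open>e > 0\<close> by (auto simp: algebra_simps)
    define h where "h = min d d' / 2"
    have h: "0 < h" "h < d" "h < d'" using d(1) d'(1) by (auto simp: h_def)
    have "norm ((h * h) *\<^sub>R (?A - ?B)) = norm ((?D h - (h * h) *\<^sub>R ?B) - (?D h - (h * h) *\<^sub>R ?A))"
      by (simp add: algebra_simps)
    also have "\<dots> \<le> e / 2 * (h * h) + e / 2 * (h * h)"
      using d(2)[OF h(1,2)] d'(2)[OF h(1,3)] norm_triangle_ineq4 by (meson add_mono order_trans)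
    finally have "(h * h) * norm (?A - ?B) \<le> (h * h) * e"
      by (simp only: norm_scaleR) (simp add: mult.commute)
    then show ?thesis using h by simp
  qed
  then have "norm (?A - ?B) \<le> 0" using field_le_epsilon[of "norm (?A - ?B)" 0] by simp
  then show ?thesis by simp
qed

section \<open>Charts of smooth manifolds\<close>

text \<open>
  The topological part of \<open>smooth_manifold\<close>, which is what passes to products and suffices to compute
  with representatives in charts.
\<close>

definition topological_atlas :: "('m::t2_space, 'e::real_normed_vector) charts \<Rightarrow> bool" where
  "topological_atlas c \<longleftrightarrow>
     (\<forall>p. p \<in> chart_dom c p \<and> open (chart_dom c p) \<and> open (chart_map c p ` chart_dom c p) \<and>
        homeomorphism (chart_dom c p) (chart_map c p ` chart_dom c p)
          (chart_map c p) (chart_inv c p))"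

lemma smooth_manifold_atlas: "smooth_manifold c \<Longrightarrow> topological_atlas c"
  by (simp add: smooth_manifold_def topological_atlas_def)

lemma vec_charts_simps [simp]:
  "chart_dom vec_charts p = UNIV" "chart_map vec_charts p = id" "chart_inv vec_charts p = id"
  by (auto simp: chart_dom_def chart_map_def chart_inv_def vec_charts_def fun_eq_iff inv_into_f_eq)

lemma topological_atlas_vec [simp]: "topological_atlas vec_charts"
  by (simp add: topological_atlas_def homeomorphism_def)

lemma prod_charts_simps [simp]:
  "chart_dom (prod_charts c d) (p, q) = chart_dom c p \<times> chart_dom d q"
  "chart_map (prod_charts c d) (p, q) = map_prod (chart_map c p) (chart_map d q)"
  by (auto simp: chart_dom_def chart_map_def prod_charts_def)

context
  fixes c :: "('m::t2_space, 'e::real_normed_vector) charts"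
  assumes c: "topological_atlas c"
begin

lemma chart_dom_self: "p \<in> chart_dom c p"
  using c by (simp add: topological_atlas_def)

lemma open_chart_dom: "open (chart_dom c p)"
  using c by (simp add: topological_atlas_def)

lemma open_chart_image: "open (chart_map c p ` chart_dom c p)"
  using c by (simp add: topological_atlas_def)

lemma continuous_on_chart_map: "continuous_on (chart_dom c p) (chart_map c p)"
  using c by (simp add: topological_atlas_def homeomorphism_def)

lemma continuous_on_chart_inv: "continuous_on (chart_map c p ` chart_dom c p) (chart_inv c p)"
  using c by (simp add: topological_atlas_def homeomorphism_def)

lemma chart_inv_map: "q \<in> chart_dom c p \<Longrightarrow> chart_inv c p (chart_map c p q) = q"
  using c by (simp add: topological_atlas_def homeomorphism_def)

lemma chart_map_inv: "u \<in> chart_map c p ` chart_dom c p \<Longrightarrow> chart_map c p (chart_inv c p u) = u"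
  by (auto simp: chart_inv_map)

lemma chart_inv_in_dom: "u \<in> chart_map c p ` chart_dom c p \<Longrightarrow> chart_inv c p u \<in> chart_dom c p"
  by (auto simp: chart_inv_map)

lemma inj_on_chart_map: "inj_on (chart_map c p) (chart_dom c p)"
  by (rule inj_on_inverseI[of _ "chart_inv c p"]) (rule chart_inv_map)

lemma isCont_chart_inv:
  "q \<in> chart_dom c p \<Longrightarrow> isCont (chart_inv c p) (chart_map c p q)"
  using continuous_on_chart_inv open_chart_image by (simp add: continuous_on_eq_continuous_at)

lemma eventually_isCont_chart_inv:
  assumes "q \<in> chart_dom c p" and "isCont f q" and "open V" and "f q \<in> V"
  shows "\<forall>\<^sub>F u in nhds (chart_map c p q). f (chart_inv c p u) \<in> V"
proof -
  have "isCont (\<lambda>u. f (chart_inv c p u)) (chart_map c p q)"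
    using assms by (intro isCont_o2[OF isCont_chart_inv]) (simp_all add: chart_inv_map)
  moreover have "f (chart_inv c p (chart_map c p q)) \<in> V" using assms by (simp add: chart_inv_map)
  ultimately show ?thesis
    using assms(3) by (auto simp: continuous_at_open eventually_nhds)
qed

end

text \<open>
  Outside of the product of the chart images, the inverse of the product chart has an unspecified value
  which need not be a pair of chart inverses. This is why representatives of maps on product manifolds are
  identified only near a point below.
\<close>

lemma chart_inv_prod:
  assumes "topological_atlas c" and "topological_atlas d"
    and "u \<in> chart_map c p ` chart_dom c p" and "v \<in> chart_map d q ` chart_dom d q"
  shows "chart_inv (prod_charts c d) (p, q) (u, v) = (chart_inv c p u, chart_inv d q v)"
  unfolding chart_inv_def[of "prod_charts c d"]
proof (rule inv_into_f_eq)
  show "inj_on (chart_map (prod_charts c d) (p, q)) (chart_dom (prod_charts c d) (p, q))"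
    using assms by (simp add: map_prod_inj_on inj_on_chart_map)
qed (use assms in \<open>auto simp: chart_inv_map\<close>)

lemma topological_atlas_prod:
  assumes "topological_atlas c" and "topological_atlas d"
  shows "topological_atlas (prod_charts c d)"
proof -
  have "homeomorphism (chart_dom (prod_charts c d) (p, q))
      (chart_map (prod_charts c d) (p, q) ` chart_dom (prod_charts c d) (p, q))
      (chart_map (prod_charts c d) (p, q)) (chart_inv (prod_charts c d) (p, q))" for p q
  proof -
    let ?I = "chart_map c p ` chart_dom c p" and ?J = "chart_map d q ` chart_dom d q"
    have img: "chart_map (prod_charts c d) (p, q) ` chart_dom (prod_charts c d) (p, q) = ?I \<times> ?J"
      by (simp add: map_prod_surj_on)
    have "continuous_on (?I \<times> ?J) (\<lambda>x. (chart_inv c p (fst x), chart_inv d q (snd x)))"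
      using assms
      by (intro continuous_intros continuous_on_compose2[OF continuous_on_chart_inv]) auto
    then have "continuous_on (?I \<times> ?J) (chart_inv (prod_charts c d) (p, q))"
      by (rule continuous_on_eq) (auto simp: chart_inv_prod[OF assms])
    moreover have "continuous_on (chart_dom c p \<times> chart_dom d q)
        (map_prod (chart_map c p) (chart_map d q))"
      unfolding map_prod_def case_prod_unfold using assms
      by (intro continuous_intros continuous_on_compose2[OF continuous_on_chart_map]) auto
    moreover have "chart_inv (prod_charts c d) (p, q) (chart_map c p x, chart_map d q y) = (x, y)"
      if "x \<in> chart_dom c p" "y \<in> chart_dom d q" for x y
      using that by (simp add: chart_inv_prod[OF assms] chart_inv_map assms)
    ultimately show ?thesis
      unfolding img by (intro homeomorphismI) (auto simp: map_prod_def)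
  qed
  then show ?thesis
    using assms unfolding topological_atlas_def
    by (auto simp: map_prod_surj_on open_Times)
qed

lemma smooth_on_differentiable: "smooth_on S f \<Longrightarrow> x \<in> S \<Longrightarrow> f differentiable (at x)"
  unfolding smooth_on_def by (metis Ck_on.simps(2))

lemma smooth_map_differentiable:
  assumes "smooth_map c d f" and "p \<in> chart_dom c a" and "f p \<in> chart_dom d b"
  shows "(chart_map d b \<circ> f \<circ> chart_inv c a) differentiable (at (chart_map c a p))"
  using assms by (auto simp: smooth_map_def intro!: smooth_on_differentiable)

lemma smooth_map_isCont: "smooth_map c d f \<Longrightarrow> isCont f p"
  by (simp add: smooth_map_def continuous_on_eq_continuous_at)

lemma smooth_manifold_transition:
  assumes "smooth_manifold c" and "p \<in> chart_dom c a" and "p \<in> chart_dom c b"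
  shows "(chart_map c b \<circ> chart_inv c a) differentiable (at (chart_map c a p))"
  using assms by (auto simp: smooth_manifold_def intro!: smooth_on_differentiable)

lemma has_derivative_transform_nhds:
  assumes "(f has_derivative f') (at a)" and "\<forall>\<^sub>F x in nhds a. f x = g x"
  shows "(g has_derivative f') (at a)"
  using assms(1)
proof (rule has_derivative_transform_eventually)
  show "\<forall>\<^sub>F x in at a. f x = g x" using assms(2) by (simp add: eventually_nhds_conv_at)
  show "f a = g a" using assms(2) by (rule eventually_nhds_x_imp_x)
qed simp

lemma frechet_derivative_transform_nhds:
  assumes "\<forall>\<^sub>F x in nhds a. f x = g x"
  shows "frechet_derivative f (at a) = frechet_derivative g (at a)"
proof -
  have "\<forall>\<^sub>F x in nhds a. g x = f x" using assms by eventually_elim simp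
  then have "(f has_derivative f') (at a) \<longleftrightarrow> (g has_derivative f') (at a)" for f'
    using assms has_derivative_transform_nhds by blast
  then show ?thesis by (simp add: frechet_derivative_def)
qed

text \<open>
  The chain rule for the passage from the chart at \<open>f p\<close>, in which tangent vectors at \<open>f p\<close> are
  represented, to a fixed chart \<open>b\<close>.
\<close>

lemma tangent_map_chart_chain:
  assumes c: "topological_atlas c" and d: "topological_atlas d"
    and f: "isCont f p" and fp: "f p \<in> chart_dom d b"
    and df: "(chart_map d (f p) \<circ> f \<circ> chart_inv c p) differentiable (at (chart_map c p p))"
    and tr: "(chart_map d b \<circ> chart_inv d (f p)) differentiable (at (chart_map d (f p) (f p)))"
  shows "tangent_map d vec_charts (chart_map d b) (f p) (tangent_map c d f p v) =
    frechet_derivative (chart_map d b \<circ> f \<circ> chart_inv c p) (at (chart_map c p p)) v"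
proof -
  let ?F = "chart_map d (f p) \<circ> f \<circ> chart_inv c p"
  let ?T = "chart_map d b \<circ> chart_inv d (f p)"
  have at: "?F (chart_map c p p) = chart_map d (f p) (f p)"
    by (simp add: chart_inv_map chart_dom_self c)
  have chain: "frechet_derivative (?T \<circ> ?F) (at (chart_map c p p)) =
      frechet_derivative ?T (at (chart_map d (f p) (f p))) \<circ> frechet_derivative ?F (at (chart_map c p p))"
    using frechet_derivative_compose[of ?F "chart_map c p p" ?T] df tr unfolding at by blast
  have "\<forall>\<^sub>F u in nhds (chart_map c p p). f (chart_inv c p u) \<in> chart_dom d (f p)"
    using eventually_isCont_chart_inv[OF c chart_dom_self[OF c] f open_chart_dom[OF d] chart_dom_self[OF d]] .
  then have "\<forall>\<^sub>F u in nhds (chart_map c p p). (?T \<circ> ?F) u = (chart_map d b \<circ> f \<circ> chart_inv c p) u"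
    by eventually_elim (simp add: chart_inv_map[OF d])
  from frechet_derivative_transform_nhds[OF this] show ?thesis
    using chain by (simp add: tangent_map_def o_def fun_eq_iff)
qed

section \<open>The Lie bracket in a chart at the identity\<close>

context lie_group
begin

abbreviation chart_at_one :: "'g \<Rightarrow> 'e" ("\<phi>") where
  "\<phi> \<equiv> chart_map (charts G) \<one>"

abbreviation inv_chart_at_one :: "'e \<Rightarrow> 'g" ("\<psi>") where
  "\<psi> \<equiv> chart_inv (charts G) \<one>"

abbreviation chart_range :: "'e set" ("W") where
  "W \<equiv> \<phi> ` chart_dom (charts G) \<one>"

abbreviation origin :: 'e ("o\<^sub>e") where
  "o\<^sub>e \<equiv> \<phi> \<one>"

definition local_mult :: "'e \<times> 'e \<Rightarrow> 'e" where
  "local_mult = \<phi> \<circ> (\<lambda>(x, y). x \<otimes> y) \<circ> chart_inv (prod_charts (charts G) (charts G)) (\<one>, \<one>)"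

definition local_inv :: "'e \<Rightarrow> 'e" where
  "local_inv = \<phi> \<circ> (\<lambda>x. inv x) \<circ> \<psi>"

definition local_mult_dom :: "('e \<times> 'e) set" where
  "local_mult_dom = {(u, v). u \<in> W \<and> v \<in> W \<and> \<psi> u \<otimes> \<psi> v \<in> chart_dom (charts G) \<one>}"

abbreviation D_mult :: "'e \<times> 'e \<Rightarrow> 'e \<times> 'e \<Rightarrow> 'e" where
  "D_mult p \<equiv> frechet_derivative local_mult (at p)"

abbreviation D2_mult :: "'e \<times> 'e \<Rightarrow> 'e \<times> 'e \<Rightarrow> 'e" where
  "D2_mult v w \<equiv> frechet_derivative (\<lambda>p. D_mult p v) (at (o\<^sub>e, o\<^sub>e)) w"

lemma in_carrier [simp]: "x \<in> carrier G"
  by (simp add: carrier_UNIV)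

lemma atlas: "topological_atlas (charts G)"
  by (rule smooth_manifold_atlas) (rule manifold)

lemma one_in_dom [simp]: "\<one> \<in> chart_dom (charts G) \<one>"
  by (rule chart_dom_self[OF atlas])

lemma origin_in_range [simp]: "o\<^sub>e \<in> W"
  by (rule imageI) simp

lemma psi_origin [simp]: "\<psi> o\<^sub>e = \<one>"
  by (simp add: chart_inv_map[OF atlas])

lemma phi_psi [simp]: "u \<in> W \<Longrightarrow> \<phi> (\<psi> u) = u"
  by (rule chart_map_inv[OF atlas])

lemma psi_in_dom [simp]: "u \<in> W \<Longrightarrow> \<psi> u \<in> chart_dom (charts G) \<one>"
  by (rule chart_inv_in_dom[OF atlas])

lemma finite_dimensional_model: obtains B :: "'e set" where "finite B" and "span B = UNIV"
  using manifold by (auto simp: smooth_manifold_def)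

lemma isCont_left_mult: "isCont (\<lambda>y. x \<otimes> y) z"
proof -
  have "isCont (\<lambda>y. (x, y)) z" by (intro continuous_intros)
  from isCont_o2[OF this smooth_map_isCont[OF smooth_mult]] show ?thesis by simp
qed

lemma isCont_inv: "isCont (\<lambda>x. inv x) z"
  by (rule smooth_map_isCont[OF smooth_inv])

lemma local_mult_eq: "u \<in> W \<Longrightarrow> v \<in> W \<Longrightarrow> local_mult (u, v) = \<phi> (\<psi> u \<otimes> \<psi> v)"
  by (simp add: local_mult_def chart_inv_prod[OF atlas atlas])

lemma local_mult_origin [simp]:
  "u \<in> W \<Longrightarrow> local_mult (u, o\<^sub>e) = u" "u \<in> W \<Longrightarrow> local_mult (o\<^sub>e, u) = u"
  by (simp_all add: local_mult_eq)

lemma open_range: "open W"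
  by (rule open_chart_image[OF atlas])

lemma origin_in_mult_dom:
  "u \<in> W \<Longrightarrow> (u, o\<^sub>e) \<in> local_mult_dom" "u \<in> W \<Longrightarrow> (o\<^sub>e, u) \<in> local_mult_dom"
  by (simp_all add: local_mult_dom_def)

lemma open_local_mult_dom: "open local_mult_dom"
proof -
  let ?f = "(\<lambda>(x, y). x \<otimes> y) \<circ> (\<lambda>p. (\<psi> (fst p), \<psi> (snd p)))"
  have "continuous_on (W \<times> W) (\<lambda>p. \<psi> (fst p))" "continuous_on (W \<times> W) (\<lambda>p. \<psi> (snd p))"
    by (rule continuous_on_compose2[OF continuous_on_chart_inv[OF atlas]];
        auto intro: continuous_intros)+
  then have "continuous_on (W \<times> W) (\<lambda>p. (\<psi> (fst p), \<psi> (snd p)))"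
    by (rule continuous_on_Pair)
  moreover have "continuous_on UNIV (\<lambda>(x, y). x \<otimes> y)"
    using smooth_mult by (simp add: smooth_map_def)
  ultimately have "continuous_on (W \<times> W) ?f"
    by (intro continuous_on_compose) (auto elim: continuous_on_subset)
  then have "open (?f -` chart_dom (charts G) \<one> \<inter> (W \<times> W))"
    using continuous_on_open_vimage[OF open_Times[OF open_range open_range]] open_chart_dom[OF atlas] by blast
  also have "\<dots> = local_mult_dom"
    by (auto simp: local_mult_dom_def)
  finally show ?thesis .
qed

lemma Ck_local_mult: "Ck_on n local_mult_dom local_mult"
proof -
  let ?cc = "prod_charts (charts G) (charts G)"
  have "smooth_on (chart_map ?cc (\<one>, \<one>) `
      (chart_dom ?cc (\<one>, \<one>) \<inter> (\<lambda>(x, y). x \<otimes> y) -` chart_dom (charts G) \<one>)) local_mult"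
    using spec[OF spec[OF conjunct2[OF smooth_mult[unfolded smooth_map_def]]], of "(\<one>, \<one>)" "\<one>"]
    unfolding local_mult_def .
  also have "chart_map ?cc (\<one>, \<one>) `
      (chart_dom ?cc (\<one>, \<one>) \<inter> (\<lambda>(x, y). x \<otimes> y) -` chart_dom (charts G) \<one>) = local_mult_dom"
    by (auto simp: local_mult_dom_def chart_inv_map[OF atlas] image_iff Bex_def)
  finally show ?thesis by (simp add: smooth_on_def)
qed

lemma D_mult: "p \<in> local_mult_dom \<Longrightarrow> (local_mult has_derivative D_mult p) (at p)"
  using Ck_local_mult[of 1] by (simp add: frechet_derivative_works)

lemma linear_D_mult: "p \<in> local_mult_dom \<Longrightarrow> linear (D_mult p)"
  by (rule has_derivative_linear[OF D_mult])

lemma D2_mult: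
  "((\<lambda>p. D_mult p v) has_derivative D2_mult v) (at (o\<^sub>e, o\<^sub>e))"
  using Ck_local_mult[of 2] origin_in_mult_dom[OF origin_in_range]
  by (cases v) (simp add: numeral_2_eq_2 frechet_derivative_works)

lemma D2_mult_symmetric: "D2_mult v w = D2_mult w v"
  by (rule second_derivative_symmetric[OF open_local_mult_dom _ Ck_local_mult])
     (rule origin_in_mult_dom[OF origin_in_range])

text \<open>
  Linearity in the direction \<open>w\<close> of the outer derivative is immediate; in the other slot, boundedness is
  obtained from symmetry.
\<close>

lemma bounded_linear_D2_mult: "bounded_linear (D2_mult v)" "bounded_linear (\<lambda>v. D2_mult v w)"
proof -
  show "bounded_linear (D2_mult v)" for v by (rule has_derivative_bounded_linear[OF D2_mult])
  from this[of w] show "bounded_linear (\<lambda>v. D2_mult v w)"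
    by (subst D2_mult_symmetric)
qed

lemma D_mult_origin:
  assumes "u \<in> W"
  shows "D_mult (u, o\<^sub>e) (h, 0) = h" and "D_mult (o\<^sub>e, u) (0, h) = h"
proof -
  have nb: "\<forall>\<^sub>F x in nhds u. x \<in> W"
    using open_range assms by (rule eventually_nhds_in_open)
  have "((\<lambda>x. (x, o\<^sub>e)) has_derivative (\<lambda>h. (h, 0))) (at u)"
    by (auto intro!: derivative_eq_intros)
  from has_derivative_compose[OF this D_mult[OF origin_in_mult_dom(1)[OF assms]]]
  have "((\<lambda>x. x) has_derivative (\<lambda>h. D_mult (u, o\<^sub>e) (h, 0))) (at u)"
    by (rule has_derivative_transform_nhds) (use nb in \<open>auto elim: eventually_mono\<close>)
  from has_derivative_unique[OF this has_derivative_ident] show "D_mult (u, o\<^sub>e) (h, 0) = h"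
    by meson
  have "((\<lambda>x. (o\<^sub>e, x)) has_derivative (\<lambda>h. (0, h))) (at u)"
    by (auto intro!: derivative_eq_intros)
  from has_derivative_compose[OF this D_mult[OF origin_in_mult_dom(2)[OF assms]]]
  have "((\<lambda>x. x) has_derivative (\<lambda>h. D_mult (o\<^sub>e, u) (0, h))) (at u)"
    by (rule has_derivative_transform_nhds) (use nb in \<open>auto elim: eventually_mono\<close>)
  from has_derivative_unique[OF this has_derivative_ident] show "D_mult (o\<^sub>e, u) (0, h) = h"
    by meson
qed

lemma D_mult_one: "D_mult (o\<^sub>e, o\<^sub>e) (a, b) = a + b"
  using linear_add[OF linear_D_mult, of "(o\<^sub>e, o\<^sub>e)" "(a, 0)" "(0, b)"]
  by (simp add: D_mult_origin origin_in_mult_dom)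

text \<open>
  This and \<open>D_mult_origin\<close> express that the identity is neutral: \<open>m (u, o) = u\<close> is linear in \<open>u\<close>.
\<close>

lemma D2_mult_diagonal: "D2_mult (h, 0) (k, 0) = 0"
proof -
  have "((\<lambda>x. (x, o\<^sub>e)) has_derivative (\<lambda>h. (h, 0))) (at o\<^sub>e)"
    by (auto intro!: derivative_eq_intros)
  from has_derivative_compose[OF this, where g = "\<lambda>p. D_mult p (h, 0)", OF D2_mult]
  have "((\<lambda>x. h) has_derivative (\<lambda>k. D2_mult (h, 0) (k, 0))) (at o\<^sub>e)"
    by (rule has_derivative_transform_nhds)
       (use eventually_nhds_in_open[OF open_range origin_in_range] in \<open>auto elim!: eventually_mono simp: D_mult_origin\<close>)
  from has_derivative_unique[OF this has_derivative_const] show ?thesis by meson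
qed

lemma eventually_in_range: "\<forall>\<^sub>F u in nhds o\<^sub>e. u \<in> W"
  using open_range origin_in_range by (rule eventually_nhds_in_open)

lemma eventually_mult_dom:
  assumes "isCont f x" and "f x \<in> local_mult_dom"
  shows "\<forall>\<^sub>F u in nhds x. f u \<in> local_mult_dom"
  using assms open_local_mult_dom
  by (auto simp: continuous_at_open eventually_nhds)

lemma left_mult_differentiable:
  "(chart_map (charts G) x \<circ> (\<lambda>y. x \<otimes> y) \<circ> \<psi>) differentiable (at o\<^sub>e)"
proof -
  let ?cc = "prod_charts (charts G) (charts G)"
  have "(chart_map (charts G) x \<circ> (\<lambda>(x, y). x \<otimes> y) \<circ> chart_inv ?cc (x, \<one>))
      differentiable (at (chart_map ?cc (x, \<one>) (x, \<one>)))"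
    by (rule smooth_map_differentiable[OF smooth_mult]) (simp_all add: chart_dom_self[OF atlas])
  then obtain f' where f': "((chart_map (charts G) x \<circ> (\<lambda>(x, y). x \<otimes> y) \<circ> chart_inv ?cc (x, \<one>))
      has_derivative f') (at (chart_map (charts G) x x, o\<^sub>e))"
    by (auto simp: differentiable_def)
  have "((\<lambda>u. (chart_map (charts G) x x, u)) has_derivative (\<lambda>h. (0, h))) (at o\<^sub>e)"
    by (auto intro!: derivative_eq_intros)
  from has_derivative_compose[OF this f']
  have "((chart_map (charts G) x \<circ> (\<lambda>y. x \<otimes> y) \<circ> \<psi>) has_derivative (\<lambda>h. f' (0, h))) (at o\<^sub>e)"
    by (rule has_derivative_transform_nhds)
       (use eventually_in_range in \<open>auto elim!: eventually_mono
          simp: chart_inv_prod[OF atlas atlas] chart_dom_self[OF atlas] chart_inv_map[OF atlas]\<close>)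
  then show ?thesis by (auto simp: differentiable_def)
qed

lemma tangent_left_has_derivative:
  "((chart_map (charts G) x \<circ> (\<lambda>y. x \<otimes> y) \<circ> \<psi>) has_derivative tangent_left G x) (at o\<^sub>e)"
  using left_mult_differentiable[of x]
  by (simp add: tangent_left_def tangent_map_def frechet_derivative_works)

lemma bounded_linear_tangent_left: "bounded_linear (tangent_left G x)"
  by (rule has_derivative_bounded_linear[OF tangent_left_has_derivative])

lemma tangent_left_one: "tangent_left G \<one> \<xi> = \<xi>"
proof -
  have "((\<lambda>u. u) has_derivative tangent_left G \<one>) (at o\<^sub>e)"
    using tangent_left_has_derivative[of \<one>]
    by (rule has_derivative_transform_nhds) (use eventually_in_range in \<open>auto elim!: eventually_mono\<close>)
  from has_derivative_unique[OF this has_derivative_ident] show ?thesis by simp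
qed

text \<open>
  The left invariant field at \<open>\<psi> u\<close> is the velocity of \<open>v \<mapsto> \<psi> u \<otimes> \<psi> v\<close>; in the chart at the identity this
  is the derivative of \<open>m (u, \<cdot>)\<close> at \<open>o\<close>.
\<close>

lemma vf_local_left_invariant:
  assumes "u \<in> W"
  shows "vf_local (charts G) (left_invariant_field G \<xi>) \<one> u = D_mult (u, o\<^sub>e) (0, \<xi>)"
proof -
  let ?x = "\<psi> u"
  have "vf_local (charts G) (left_invariant_field G \<xi>) \<one> u =
      tangent_map (charts G) vec_charts \<phi> (?x \<otimes> \<one>) (tangent_map (charts G) (charts G) (\<lambda>y. ?x \<otimes> y) \<one> \<xi>)"
    by (simp add: vf_local_def left_invariant_field_def tangent_left_def)
  also have "\<dots> = frechet_derivative (\<phi> \<circ> (\<lambda>y. ?x \<otimes> y) \<circ> \<psi>) (at o\<^sub>e) \<xi>"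
    by (rule tangent_map_chart_chain[OF atlas atlas isCont_left_mult])
       (use assms left_mult_differentiable[of ?x] in
         \<open>auto intro!: smooth_manifold_transition[OF manifold] chart_dom_self[OF atlas] simp: chart_inv_map[OF atlas]\<close>)
  also have "\<dots> = frechet_derivative (\<lambda>v. local_mult (u, v)) (at o\<^sub>e) \<xi>"
    by (rule fun_cong[OF frechet_derivative_transform_nhds])
       (use eventually_in_range assms in \<open>auto elim!: eventually_mono simp: local_mult_eq\<close>)
  also have "\<dots> = D_mult (u, o\<^sub>e) (0, \<xi>)"
  proof -
    have "((\<lambda>v. (u, v)) has_derivative (\<lambda>h. (0, h))) (at o\<^sub>e)"
      by (auto intro!: derivative_eq_intros)
    from has_derivative_compose[OF this D_mult[OF origin_in_mult_dom(1)[OF assms]]]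
    show ?thesis by (simp add: frechet_derivative_at[symmetric])
  qed
  finally show ?thesis .
qed

lemma vf_local_left_invariant_has_derivative:
  "(vf_local (charts G) (left_invariant_field G \<xi>) \<one> has_derivative (\<lambda>h. D2_mult (0, \<xi>) (h, 0))) (at o\<^sub>e)"
proof -
  have "((\<lambda>u. (u, o\<^sub>e)) has_derivative (\<lambda>h. (h, 0))) (at o\<^sub>e)"
    by (auto intro!: derivative_eq_intros)
  from has_derivative_compose[OF this, where g = "\<lambda>p. D_mult p (0, \<xi>)", OF D2_mult]
  show ?thesis
    by (rule has_derivative_transform_nhds)
       (use eventually_in_range in \<open>auto elim!: eventually_mono simp: vf_local_left_invariant\<close>)
qed

lemma ad_eq: "ad G \<xi> \<eta> = D2_mult (0, \<eta>) (\<xi>, 0) - D2_mult (0, \<xi>) (\<eta>, 0)"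
  unfolding ad_def vf_bracket_def
  by (simp add: frechet_derivative_at[OF vf_local_left_invariant_has_derivative, symmetric])
     (simp add: left_invariant_field_def tangent_left_one)

lemma ad_antisym: "ad G \<eta> \<xi> = - ad G \<xi> \<eta>"
  by (simp add: ad_eq)

lemma bounded_linear_ad_right: "bounded_linear (ad G \<xi>)"
proof -
  have "bounded_linear (\<lambda>h. D2_mult (0, h) (\<xi>, 0))" for \<xi>
    by (rule bounded_linear_compose[OF bounded_linear_D2_mult(2)])
       (intro bounded_linear_Pair bounded_linear_zero bounded_linear_ident)
  moreover have "bounded_linear (\<lambda>h. D2_mult (0, \<xi>) (h, 0))" for \<xi>
    by (rule bounded_linear_compose[OF bounded_linear_D2_mult(1)])
       (intro bounded_linear_Pair bounded_linear_zero bounded_linear_ident)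
  ultimately have "bounded_linear (\<lambda>h. D2_mult (0, h) (\<xi>, 0) - D2_mult (0, \<xi>) (h, 0))"
    by (rule bounded_linear_sub)
  then show ?thesis by (simp add: ad_eq[abs_def])
qed

lemma bounded_linear_ad_left: "bounded_linear (\<lambda>\<xi>. ad G \<xi> \<eta>)"
  by (subst ad_antisym) (rule bounded_linear_minus[OF bounded_linear_ad_right])

section \<open>The derivative of the adjoint action\<close>

lemma local_inv_eq: "u \<in> W \<Longrightarrow> inv (\<psi> u) \<in> chart_dom (charts G) \<one> \<Longrightarrow>
    local_inv u \<in> W \<and> \<psi> (local_inv u) = inv (\<psi> u)"
  by (simp add: local_inv_def chart_inv_map[OF atlas])

lemma eventually_inv_in_dom: "\<forall>\<^sub>F u in nhds o\<^sub>e. inv (\<psi> u) \<in> chart_dom (charts G) \<one>"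
  by (rule eventually_isCont_chart_inv[OF atlas one_in_dom isCont_inv open_chart_dom[OF atlas]]) simp

lemma local_inv_origin [simp]: "local_inv o\<^sub>e = o\<^sub>e"
  by (simp add: local_inv_def)

text \<open>
  Differentiate \<open>m (u, i u) = o\<close>.
\<close>

lemma local_inv_has_derivative: "(local_inv has_derivative (\<lambda>h. - h)) (at o\<^sub>e)"
proof -
  have "local_inv differentiable (at o\<^sub>e)"
    unfolding local_inv_def by (rule smooth_map_differentiable[OF smooth_inv]) simp_all
  then obtain i' where i': "(local_inv has_derivative i') (at o\<^sub>e)"
    by (auto simp: differentiable_def)
  have "((\<lambda>u. (u, local_inv u)) has_derivative (\<lambda>h. (h, i' h))) (at o\<^sub>e)"
    by (auto intro!: derivative_eq_intros i')
  moreover have "(local_mult has_derivative D_mult (o\<^sub>e, o\<^sub>e)) (at (o\<^sub>e, local_inv o\<^sub>e))"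
    using D_mult[OF origin_in_mult_dom(1)[OF origin_in_range]] by simp
  ultimately have "((\<lambda>u. local_mult (u, local_inv u)) has_derivative (\<lambda>h. D_mult (o\<^sub>e, o\<^sub>e) (h, i' h))) (at o\<^sub>e)"
    by (rule has_derivative_compose)
  then have "((\<lambda>u. local_mult (u, local_inv u)) has_derivative (\<lambda>h. h + i' h)) (at o\<^sub>e)"
    by (simp add: D_mult_one)
  then have "((\<lambda>u. o\<^sub>e) has_derivative (\<lambda>h. h + i' h)) (at o\<^sub>e)"
  proof (rule has_derivative_transform_nhds)
    show "\<forall>\<^sub>F u in nhds o\<^sub>e. local_mult (u, local_inv u) = o\<^sub>e"
      using eventually_in_range eventually_inv_in_dom
      by eventually_elim (simp add: local_inv_eq local_mult_eq r_inv)
  qed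
  from has_derivative_unique[OF this has_derivative_const] have "h + i' h = 0" for h by meson
  then have "i' = (\<lambda>h. - h)" by (simp add: fun_eq_iff eq_neg_iff_add_eq_0 add.commute)
  then show ?thesis using i' by simp
qed

lemma Ad_one: "Ad G \<one> \<xi> = \<xi>"
proof -
  have "Ad G \<one> \<xi> = frechet_derivative (\<phi> \<circ> (\<lambda>y. \<one> \<otimes> y \<otimes> inv \<one>) \<circ> \<psi>) (at o\<^sub>e) \<xi>"
    by (simp add: Ad_def tangent_map_def)
  also have "\<dots> = frechet_derivative (\<lambda>u. u) (at o\<^sub>e) \<xi>"
    by (rule fun_cong[OF frechet_derivative_transform_nhds])
       (use eventually_in_range in \<open>auto elim!: eventually_mono\<close>)
  finally show ?thesis by simp
qed

text \<open>
  Conjugation by \<open>y\<inverse>\<close>, where \<open>y = \<psi> u\<close>, is \<open>v \<mapsto> m (m (i u, v), u)\<close> in the chart, as long as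
  the intermediate product stays in the chart domain; this holds for \<open>u\<close> and \<open>v\<close> near \<open>o\<close>.
\<close>

lemma Ad_inv_local:
  "\<forall>\<^sub>F u in nhds o\<^sub>e. Ad G (inv (\<psi> u)) \<zeta> =
     D_mult (local_inv u, u) (D_mult (local_inv u, o\<^sub>e) (0, \<zeta>), 0)"
proof -
  have ci: "isCont (\<lambda>u. (local_inv u, u)) o\<^sub>e"
    using has_derivative_continuous[OF local_inv_has_derivative] by (intro continuous_intros) auto
  have "\<forall>\<^sub>F u in nhds o\<^sub>e. (local_inv u, u) \<in> local_mult_dom"
    by (rule eventually_mult_dom[OF ci]) (simp add: origin_in_mult_dom)
  with eventually_in_range eventually_inv_in_dom
  show ?thesis
  proof eventually_elim
    case (elim u)
    let ?x = "\<psi> u" and ?i = "local_inv u"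
    have i: "?i \<in> W" "\<psi> ?i = inv ?x" using local_inv_eq elim by auto
    have dm: "(?i, o\<^sub>e) \<in> local_mult_dom" by (rule origin_in_mult_dom(1)[OF i(1)])
    have "((\<lambda>v. (?i, v)) has_derivative (\<lambda>h. (0, h))) (at o\<^sub>e)"
      by (auto intro!: derivative_eq_intros)
    from has_derivative_compose[OF this D_mult[OF dm]]
    have d1: "((\<lambda>v. local_mult (?i, v)) has_derivative (\<lambda>h. D_mult (?i, o\<^sub>e) (0, h))) (at o\<^sub>e)" .
    have "((\<lambda>v. (local_mult (?i, v), u)) has_derivative (\<lambda>h. (D_mult (?i, o\<^sub>e) (0, h), 0))) (at o\<^sub>e)"
      by (auto intro!: derivative_eq_intros d1)
    from has_derivative_compose[OF this, of local_mult "D_mult (?i, u)"] D_mult[OF elim(3)]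
    have d2: "((\<lambda>v. local_mult (local_mult (?i, v), u)) has_derivative
        (\<lambda>h. D_mult (?i, u) (D_mult (?i, o\<^sub>e) (0, h), 0))) (at o\<^sub>e)"
      using i(1) by simp
    have "isCont (\<lambda>v. (?i, v)) o\<^sub>e" by (intro continuous_intros)
    then have "\<forall>\<^sub>F v in nhds o\<^sub>e. (?i, v) \<in> local_mult_dom"
      using eventually_mult_dom dm by blast
    with eventually_in_range
    have "\<forall>\<^sub>F v in nhds o\<^sub>e. local_mult (local_mult (?i, v), u) =
        (\<phi> \<circ> (\<lambda>y. inv ?x \<otimes> y \<otimes> inv (inv ?x)) \<circ> \<psi>) v"
    proof eventually_elim
      case (elim v)
      then show ?case
        using i \<open>u \<in> W\<close>
        by (simp add: local_mult_eq local_mult_dom_def chart_inv_map[OF atlas])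
    qed
    from has_derivative_transform_nhds[OF d2 this]
    show "Ad G (inv ?x) \<zeta> = D_mult (?i, u) (D_mult (?i, o\<^sub>e) (0, \<zeta>), 0)"
      by (simp add: Ad_def tangent_map_def o_def frechet_derivative_at[symmetric])
  qed
qed

text \<open>
  The infinitesimal adjoint action is the bracket of left invariant fields. The sign comes from the
  inverse; symmetry of the second derivative turns the term \<open>D\<^sup>2m ((\<zeta>, 0), (0, h))\<close>, in which the second
  factor is differentiated last, into the term \<open>D\<^sup>2m ((0, h), (\<zeta>, 0))\<close> of the bracket.
\<close>

lemma Ad_inv_has_derivative:
  "((\<lambda>u. Ad G (inv (\<psi> u)) \<zeta>) has_derivative (\<lambda>h. - ad G h \<zeta>)) (at o\<^sub>e)"
proof -
  obtain B :: "'e set" where B: "finite B" "span B = UNIV"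
    by (rule finite_dimensional_model)
  have E: "(o\<^sub>e, o\<^sub>e) \<in> local_mult_dom" by (rule origin_in_mult_dom) simp
  have pd: "((\<lambda>u. (local_inv u, u)) has_derivative (\<lambda>h. (- h, h))) (at o\<^sub>e)"
    by (auto intro!: derivative_eq_intros local_inv_has_derivative)
  have qd: "((\<lambda>u. (local_inv u, o\<^sub>e)) has_derivative (\<lambda>h. (- h, 0))) (at o\<^sub>e)"
    by (auto intro!: derivative_eq_intros local_inv_has_derivative)
  \<comment> \<open>Both the base point of \<open>Dm\<close> and the vector to which it is applied depend on \<open>u\<close>.\<close>
  have lin: "\<forall>\<^sub>F u in nhds o\<^sub>e. linear (\<lambda>v. D_mult (local_inv u, u) (v, 0))"
  proof -
    have "\<forall>\<^sub>F u in nhds o\<^sub>e. (local_inv u, u) \<in> local_mult_dom"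
      using eventually_mult_dom[OF has_derivative_continuous[OF pd]] E by simp
    then show ?thesis
    proof eventually_elim
      case (elim u)
      show ?case
        by (rule linear_compose[OF _ linear_D_mult[OF elim], unfolded o_def]) (rule linearI; simp)
    qed
  qed
  have F: "((\<lambda>u. D_mult (local_inv u, u) (v, 0)) has_derivative (\<lambda>h. D2_mult (v, 0) (- h, h))) (at o\<^sub>e)" for v
    using has_derivative_compose[OF pd, where g = "\<lambda>p. D_mult p (v, 0)"] D2_mult by simp
  have w: "((\<lambda>u. D_mult (local_inv u, o\<^sub>e) (0, \<zeta>)) has_derivative (\<lambda>h. D2_mult (0, \<zeta>) (- h, 0))) (at o\<^sub>e)"
    using has_derivative_compose[OF qd, where g = "\<lambda>p. D_mult p (0, \<zeta>)"] D2_mult by simp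
  have "((\<lambda>u. D_mult (local_inv u, u) (D_mult (local_inv u, o\<^sub>e) (0, \<zeta>), 0)) has_derivative
      (\<lambda>h. D2_mult (\<zeta>, 0) (- h, h) + D2_mult (0, \<zeta>) (- h, 0))) (at o\<^sub>e)"
    using has_derivative_linear_family_apply[OF B lin F w] by (simp add: D_mult_one)
  moreover have "D2_mult (\<zeta>, 0) (- h, h) + D2_mult (0, \<zeta>) (- h, 0) = - ad G h \<zeta>" for h
  proof -
    have lD: "linear (D2_mult v)" for v
      using bounded_linear_D2_mult(1) by (rule bounded_linear.linear)
    have "D2_mult (\<zeta>, 0) (- h, h) = - D2_mult (\<zeta>, 0) (h, 0) + D2_mult (\<zeta>, 0) (0, h)"
      using linear_add[OF lD, of "(\<zeta>, 0)" "- (h, 0)" "(0, h)"] linear_neg[OF lD, of "(\<zeta>, 0)" "(h, 0)"] by simp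
    moreover have "D2_mult (0, \<zeta>) (- h, 0) = - D2_mult (0, \<zeta>) (h, 0)"
      using linear_neg[OF lD, of "(0, \<zeta>)" "(h, 0)"] by simp
    ultimately show ?thesis
      by (simp add: ad_eq D2_mult_diagonal D2_mult_symmetric[of "(\<zeta>, 0)"])
  qed
  ultimately have "((\<lambda>u. D_mult (local_inv u, u) (D_mult (local_inv u, o\<^sub>e) (0, \<zeta>), 0)) has_derivative
      (\<lambda>h. - ad G h \<zeta>)) (at o\<^sub>e)" by simp
  then show ?thesis
    by (rule has_derivative_transform_nhds) (use Ad_inv_local[of \<zeta>] in \<open>auto elim!: eventually_mono\<close>)
qed

end

section \<open>Left translation and bracket of the second order tangent group\<close>

abbreviation times_vec2 :: "('m, 'e::real_normed_vector) charts \<Rightarrow> ('m \<times> 'e \<times> 'e, 'e \<times> 'e \<times> 'e) charts" where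
  "times_vec2 c \<equiv> prod_charts c (prod_charts vec_charts vec_charts)"

lemma second_tangent_group_simps [simp]:
  "charts (second_tangent_group G) = times_vec2 (charts G)"
  "\<one>\<^bsub>second_tangent_group G\<^esub> = (\<one>\<^bsub>G\<^esub>, 0, 0)"
  "(x, a, b) \<otimes>\<^bsub>second_tangent_group G\<^esub> (y, s, t) =
    (x \<otimes>\<^bsub>G\<^esub> y, s + Ad G (inv\<^bsub>G\<^esub> y) a,
     t + Ad G (inv\<^bsub>G\<^esub> y) b - ad G s (Ad G (inv\<^bsub>G\<^esub> y) a))"
  by (simp_all add: second_tangent_group_def)

lemma chart_inv_times_vec2:
  fixes c :: "('m::t2_space, 'e::real_normed_vector) charts"
  assumes "topological_atlas c" and "u \<in> chart_map c p ` chart_dom c p"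
  shows "chart_inv (times_vec2 c) (p, a, b) (u, s, t) = (chart_inv c p u, s, t)"
proof -
  have "chart_inv (prod_charts vec_charts vec_charts) (a, b) (s, t) = (s, t)"
    by (subst chart_inv_prod) simp_all
  moreover have "(s, t) \<in> chart_map (prod_charts vec_charts vec_charts) (a, b) `
      chart_dom (prod_charts vec_charts vec_charts) (a, b)"
    by (simp add: prod.map_id0)
  ultimately show ?thesis
    using assms by (subst chart_inv_prod) (simp_all add: topological_atlas_prod)
qed

text \<open>
  On the two vector space factors every chart transition is the identity.
\<close>

lemma tangent_map_chart_times_vec2:
  fixes c :: "('m::t2_space, 'e::real_normed_vector) charts"
  assumes c: "smooth_manifold c" and q: "q \<in> chart_dom c p"
  shows "tangent_map (times_vec2 c) vec_charts (chart_map (times_vec2 c) (p, a, b)) (q, s, t) (h0, h1, h2) =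
    (tangent_map c vec_charts (chart_map c p) q h0, h1, h2)"
proof -
  have atlas: "topological_atlas c" using c by (rule smooth_manifold_atlas)
  let ?u = "chart_map c q q"
  have d: "((chart_map c p \<circ> chart_inv c q) has_derivative tangent_map c vec_charts (chart_map c p) q) (at ?u)"
    using smooth_manifold_transition[OF c chart_dom_self[OF atlas] q]
    by (simp add: tangent_map_def frechet_derivative_works)
  have "((\<lambda>z. ((chart_map c p \<circ> chart_inv c q) (fst z), snd z)) has_derivative
      (\<lambda>h. (tangent_map c vec_charts (chart_map c p) q (fst h), snd h))) (at (?u, s, t))"
    by (rule has_derivative_Pair[OF has_derivative_compose[OF has_derivative_fst[OF has_derivative_ident]]
          has_derivative_snd[OF has_derivative_ident]])
       (use d in \<open>simp add: o_def\<close>)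
  then have "((chart_map (times_vec2 c) (p, a, b) \<circ> chart_inv (times_vec2 c) (q, s, t)) has_derivative
      (\<lambda>h. (tangent_map c vec_charts (chart_map c p) q (fst h), snd h))) (at (?u, s, t))"
  proof (rule has_derivative_transform_nhds)
    have "\<forall>\<^sub>F z in nhds (?u, s, t). z \<in> (chart_map c q ` chart_dom c q) \<times> UNIV"
      using open_chart_image[OF atlas] chart_dom_self[OF atlas]
      by (intro eventually_nhds_in_open open_Times) auto
    then show "\<forall>\<^sub>F z in nhds (?u, s, t). ((chart_map c p \<circ> chart_inv c q) (fst z), snd z) =
        (chart_map (times_vec2 c) (p, a, b) \<circ> chart_inv (times_vec2 c) (q, s, t)) z"
      by eventually_elim (auto simp: chart_inv_times_vec2[OF atlas])
  qed
  from frechet_derivative_at[OF this]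
  show ?thesis
    by (simp add: tangent_map_def[of "times_vec2 c"] fun_eq_iff)
qed

context lie_group
begin

abbreviation T2 :: "('g \<times> 'e \<times> 'e, 'e \<times> 'e \<times> 'e) lie_group_data" where
  "T2 \<equiv> second_tangent_group G"

lemma eventually_in_range_times:
  "\<forall>\<^sub>F z in nhds (o\<^sub>e, s :: 'e, t :: 'e). z \<in> W \<times> UNIV"
  by (intro eventually_nhds_in_open open_Times open_range) auto

text \<open>
  Differentiate the product at the identity \<open>(\<one>, 0, 0)\<close> in its right factor. The cocycle
  \<open>ad s (Ad y\<inverse> a)\<close> is bilinear in \<open>s\<close> and \<open>Ad y\<inverse> a\<close>, and \<open>s = 0\<close> at the identity, so only its
  derivative in \<open>s\<close> survives.
\<close>

lemma tangent_left_T2: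
  "tangent_left T2 (x, a, b) (h0, h1, h2) =
    (tangent_left G x h0, h1 - ad G h0 a, h2 - ad G h0 b - ad G h1 a)"
proof -
  obtain B :: "'e set" where B: "finite B" "span B = UNIV"
    by (rule finite_dimensional_model)
  let ?A = "\<lambda>v u. Ad G (inv (\<psi> u)) v"
  let ?z = "(o\<^sub>e, 0 :: 'e, 0 :: 'e)"
  let ?s = "\<lambda>z :: 'e \<times> 'e \<times> 'e. fst (snd z)" and ?t = "\<lambda>z :: 'e \<times> 'e \<times> 'e. snd (snd z)"
  have fst': "(fst has_derivative fst) (at ?z)"
    by (rule has_derivative_fst[OF has_derivative_ident])
  have s': "(?s has_derivative ?s) (at ?z)" and t': "(?t has_derivative ?t) (at ?z)"
    by (rule has_derivative_fst has_derivative_snd has_derivative_ident)+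
  have l: "((\<lambda>z. (chart_map (charts G) x \<circ> (\<lambda>y. x \<otimes> y) \<circ> \<psi>) (fst z)) has_derivative
      (\<lambda>h. tangent_left G x (fst h))) (at ?z)"
    by (rule has_derivative_compose[OF fst']) (use tangent_left_has_derivative in \<open>simp add: o_def\<close>)
  have A: "((\<lambda>z. ?A v (fst z)) has_derivative (\<lambda>h. - ad G (fst h) v)) (at ?z)" for v
    by (rule has_derivative_compose[OF fst', of "?A v"]) (use Ad_inv_has_derivative in simp)
  have F: "((\<lambda>z. ad G (?s z) v) has_derivative (\<lambda>h. ad G (?s h) v)) (at ?z)" for v
    by (rule bounded_linear.has_derivative[OF bounded_linear_ad_left s'])
  have ad0: "ad G 0 v = 0" for v
    using bounded_linear_ad_left by (rule linear_0[OF bounded_linear.linear])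
  have lin: "\<forall>\<^sub>F z in nhds ?z. linear (\<lambda>v. ad G (?s z) v)"
    by (rule always_eventually) (use bounded_linear_ad_right in \<open>blast intro: bounded_linear.linear\<close>)
  have adA: "((\<lambda>z. ad G (?s z) (?A a (fst z))) has_derivative (\<lambda>h. ad G (?s h) a)) (at ?z)"
    using has_derivative_linear_family_apply[OF B lin F A[of a]] by (simp add: Ad_one ad0)
  have "((\<lambda>z. ((chart_map (charts G) x \<circ> (\<lambda>y. x \<otimes> y) \<circ> \<psi>) (fst z),
        ?s z + ?A a (fst z), ?t z + ?A b (fst z) - ad G (?s z) (?A a (fst z)))) has_derivative
      (\<lambda>h. (tangent_left G x (fst h), ?s h + - ad G (fst h) a,
        ?t h + - ad G (fst h) b - ad G (?s h) a))) (at ?z)"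
    by (intro has_derivative_Pair has_derivative_add has_derivative_diff l A s' t' adA)
  then have "((chart_map (charts T2) ((x, a, b) \<otimes>\<^bsub>T2\<^esub> \<one>\<^bsub>T2\<^esub>) \<circ> (\<lambda>y. (x, a, b) \<otimes>\<^bsub>T2\<^esub> y) \<circ>
        chart_inv (charts T2) \<one>\<^bsub>T2\<^esub>) has_derivative
      (\<lambda>h. (tangent_left G x (fst h), ?s h + - ad G (fst h) a,
        ?t h + - ad G (fst h) b - ad G (?s h) a))) (at ?z)"
  proof (rule has_derivative_transform_nhds)
    show "\<forall>\<^sub>F z in nhds ?z. ((chart_map (charts G) x \<circ> (\<lambda>y. x \<otimes> y) \<circ> \<psi>) (fst z),
        ?s z + ?A a (fst z), ?t z + ?A b (fst z) - ad G (?s z) (?A a (fst z))) =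
      (chart_map (charts T2) ((x, a, b) \<otimes>\<^bsub>T2\<^esub> \<one>\<^bsub>T2\<^esub>) \<circ> (\<lambda>y. (x, a, b) \<otimes>\<^bsub>T2\<^esub> y) \<circ>
        chart_inv (charts T2) \<one>\<^bsub>T2\<^esub>) z"
      using eventually_in_range_times
      by eventually_elim (auto simp: chart_inv_times_vec2[OF atlas])
  qed
  from frechet_derivative_at[OF this]
  have "tangent_left T2 (x, a, b) = (\<lambda>h. (tangent_left G x (fst h), ?s h + - ad G (fst h) a,
        ?t h + - ad G (fst h) b - ad G (?s h) a))"
    by (simp add: tangent_left_def[of T2] tangent_map_def)
  then show ?thesis by simp
qed

lemma bounded_linear_tangent_left_T2: "bounded_linear (tangent_left T2 (x, a, b))"
proof -
  have "bounded_linear (\<lambda>h :: 'e \<times> 'e \<times> 'e. (tangent_left G x (fst h), fst (snd h) - ad G (fst h) a,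
      snd (snd h) - ad G (fst h) b - ad G (fst (snd h)) a))"
    by (intro bounded_linear_Pair bounded_linear_sub bounded_linear_compose[OF bounded_linear_tangent_left]
        bounded_linear_compose[OF bounded_linear_ad_left] bounded_linear_fst_comp bounded_linear_snd_comp
        bounded_linear_ident)
  moreover have "tangent_left T2 (x, a, b) = (\<lambda>h. (tangent_left G x (fst h), fst (snd h) - ad G (fst h) a,
      snd (snd h) - ad G (fst h) b - ad G (fst (snd h)) a))"
    by (auto simp: fun_eq_iff tangent_left_T2)
  ultimately show ?thesis by simp
qed

text \<open>
  In the second and third component a left invariant field is affine in the coordinates \<open>s\<close>, \<open>t\<close> and
  independent of the group coordinate, which makes its derivative in \<open>vf_local_T2_has_derivative\<close> explicit.
\<close>

lemma vf_local_T2: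
  assumes "u \<in> W"
  shows "vf_local (charts T2) (left_invariant_field T2 (\<eta>0, \<eta>1, \<eta>2)) \<one>\<^bsub>T2\<^esub> (u, s, t) =
    (vf_local (charts G) (left_invariant_field G \<eta>0) \<one> u, \<eta>1 - ad G \<eta>0 s, \<eta>2 - ad G \<eta>0 t - ad G \<eta>1 s)"
  unfolding vf_local_def left_invariant_field_def
  using assms
  by (simp add: chart_inv_times_vec2[OF atlas] tangent_left_T2
      tangent_map_chart_times_vec2[OF manifold, where p = \<one>, simplified])

lemma vf_local_T2_has_derivative:
  "(vf_local (charts T2) (left_invariant_field T2 (\<eta>0, \<eta>1, \<eta>2)) \<one>\<^bsub>T2\<^esub> has_derivative
     (\<lambda>(h0, h1, h2). (D2_mult (0, \<eta>0) (h0, 0), - ad G \<eta>0 h1, - ad G \<eta>0 h2 - ad G \<eta>1 h1)))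
     (at (o\<^sub>e, 0, 0))"
proof -
  let ?z = "(o\<^sub>e, 0 :: 'e, 0 :: 'e)"
  let ?s = "\<lambda>z :: 'e \<times> 'e \<times> 'e. fst (snd z)" and ?t = "\<lambda>z :: 'e \<times> 'e \<times> 'e. snd (snd z)"
  have fst': "(fst has_derivative fst) (at ?z)"
    by (rule has_derivative_fst[OF has_derivative_ident])
  have s': "(?s has_derivative ?s) (at ?z)" and t': "(?t has_derivative ?t) (at ?z)"
    by (rule has_derivative_fst has_derivative_snd has_derivative_ident)+
  have l: "((\<lambda>z. vf_local (charts G) (left_invariant_field G \<eta>0) \<one> (fst z)) has_derivative
      (\<lambda>h. D2_mult (0, \<eta>0) (fst h, 0))) (at ?z)"
    by (rule has_derivative_compose[OF fst']) (use vf_local_left_invariant_has_derivative in simp)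
  have "((\<lambda>z. (vf_local (charts G) (left_invariant_field G \<eta>0) \<one> (fst z),
        \<eta>1 - ad G \<eta>0 (?s z), \<eta>2 - ad G \<eta>0 (?t z) - ad G \<eta>1 (?s z))) has_derivative
      (\<lambda>h. (D2_mult (0, \<eta>0) (fst h, 0), 0 - ad G \<eta>0 (?s h), 0 - ad G \<eta>0 (?t h) - ad G \<eta>1 (?s h)))) (at ?z)"
    by (intro has_derivative_Pair has_derivative_diff has_derivative_const l
        bounded_linear.has_derivative[OF bounded_linear_ad_right] s' t')
  then have "(vf_local (charts T2) (left_invariant_field T2 (\<eta>0, \<eta>1, \<eta>2)) \<one>\<^bsub>T2\<^esub> has_derivative
      (\<lambda>h. (D2_mult (0, \<eta>0) (fst h, 0), 0 - ad G \<eta>0 (?s h), 0 - ad G \<eta>0 (?t h) - ad G \<eta>1 (?s h)))) (at ?z)"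
  proof (rule has_derivative_transform_nhds)
    show "\<forall>\<^sub>F z in nhds ?z. (vf_local (charts G) (left_invariant_field G \<eta>0) \<one> (fst z),
        \<eta>1 - ad G \<eta>0 (?s z), \<eta>2 - ad G \<eta>0 (?t z) - ad G \<eta>1 (?s z)) =
        vf_local (charts T2) (left_invariant_field T2 (\<eta>0, \<eta>1, \<eta>2)) \<one>\<^bsub>T2\<^esub> z"
      using eventually_in_range_times
      by eventually_elim (clarsimp simp only: mem_Times_iff vf_local_T2 fst_conv snd_conv split_paired_all)
  qed
  then show ?thesis by (simp add: case_prod_unfold)
qed

text \<open>
  The commutator of the fields of \<open>vf_local_T2\<close>; antisymmetry of the bracket of \<open>G\<close> turns
  \<open>[\<eta>\<^sub>1, \<zeta>\<^sub>1] - [\<zeta>\<^sub>1, \<eta>\<^sub>1]\<close> into \<open>2 [\<eta>\<^sub>1, \<zeta>\<^sub>1]\<close>.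
\<close>

lemma ad_T2:
  "ad T2 (\<eta>0, \<eta>1, \<eta>2) (\<zeta>0, \<zeta>1, \<zeta>2) =
    (ad G \<eta>0 \<zeta>0, ad G \<eta>0 \<zeta>1 + ad G \<eta>1 \<zeta>0, ad G \<eta>0 \<zeta>2 + ad G \<eta>2 \<zeta>0 + 2 *\<^sub>R ad G \<eta>1 \<zeta>1)"
proof -
  have z: "ad G \<xi> 0 = 0" for \<xi>
    using bounded_linear_ad_right by (rule linear_0[OF bounded_linear.linear])
  have at: "chart_map (charts T2) \<one>\<^bsub>T2\<^esub> \<one>\<^bsub>T2\<^esub> = (o\<^sub>e, 0, 0)" by simp
  have X: "left_invariant_field T2 (\<xi>0, \<xi>1, \<xi>2) \<one>\<^bsub>T2\<^esub> = (\<xi>0, \<xi>1, \<xi>2)" for \<xi>0 \<xi>1 \<xi>2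
    by (simp add: left_invariant_field_def tangent_left_T2 tangent_left_one z)
  have "ad T2 (\<eta>0, \<eta>1, \<eta>2) (\<zeta>0, \<zeta>1, \<zeta>2) =
     (D2_mult (0, \<zeta>0) (\<eta>0, 0), - ad G \<zeta>0 \<eta>1, - ad G \<zeta>0 \<eta>2 - ad G \<zeta>1 \<eta>1) -
     (D2_mult (0, \<eta>0) (\<zeta>0, 0), - ad G \<eta>0 \<zeta>1, - ad G \<eta>0 \<zeta>2 - ad G \<eta>1 \<zeta>1)"
    unfolding ad_def[of T2] vf_bracket_def at X
    by (simp only: frechet_derivative_at[OF vf_local_T2_has_derivative, symmetric] prod.case)
  then show ?thesis
    using ad_antisym[of \<eta>1 \<zeta>0] ad_antisym[of \<eta>2 \<zeta>0] ad_antisym[of \<eta>1 \<zeta>1]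
    by (simp add: ad_eq[of \<eta>0 \<zeta>0] scaleR_2)
qed

lemma bounded_linear_ad_T2: "bounded_linear (ad T2 (\<eta>0, \<eta>1, \<eta>2))"
proof -
  have "bounded_linear (\<lambda>h :: 'e \<times> 'e \<times> 'e. (ad G \<eta>0 (fst h), ad G \<eta>0 (fst (snd h)) + ad G \<eta>1 (fst h),
      ad G \<eta>0 (snd (snd h)) + ad G \<eta>2 (fst h) + 2 *\<^sub>R ad G \<eta>1 (fst (snd h))))"
    by (intro bounded_linear_Pair bounded_linear_add bounded_linear_compose[OF bounded_linear_ad_right]
        bounded_linear_compose[OF bounded_linear_scaleR_right] bounded_linear_fst_comp bounded_linear_snd_comp
        bounded_linear_ident)
  moreover have "ad T2 (\<eta>0, \<eta>1, \<eta>2) = (\<lambda>h. (ad G \<eta>0 (fst h), ad G \<eta>0 (fst (snd h)) + ad G \<eta>1 (fst h),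
      ad G \<eta>0 (snd (snd h)) + ad G \<eta>2 (fst h) + 2 *\<^sub>R ad G \<eta>1 (fst (snd h))))"
    by (auto simp: fun_eq_iff ad_T2)
  ultimately show ?thesis by simp
qed

end

section \<open>Dual maps and partial derivatives\<close>

text \<open>
  Boundedness is a genuine condition: \<open>Blinfun\<close> has no useful value at a map that is not bounded linear.
\<close>

lemma coad_apply:
  assumes "bounded_linear (ad G \<xi>)"
  shows "blinfun_apply (coad G \<xi> \<mu>) \<zeta> = - \<mu> (ad G \<xi> \<zeta>)"
proof -
  have "bounded_linear (\<lambda>\<zeta>. - blinfun_apply \<mu> (ad G \<xi> \<zeta>))"
    by (intro bounded_linear_minus bounded_linear_compose[OF blinfun.bounded_linear_right assms])
  then show ?thesis by (simp add: coad_def bounded_linear_Blinfun_apply)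
qed

lemma cotangent_left_apply:
  assumes "bounded_linear (tangent_left G x)"
  shows "blinfun_apply (cotangent_left G x \<alpha>) \<zeta> = \<alpha> (tangent_left G x \<zeta>)"
proof -
  have "bounded_linear (\<lambda>\<zeta>. blinfun_apply \<alpha> (tangent_left G x \<zeta>))"
    by (intro bounded_linear_compose[OF blinfun.bounded_linear_right assms])
  then show ?thesis by (simp add: cotangent_left_def bounded_linear_Blinfun_apply)
qed

lemma cotangent_left_additive_group: "cotangent_left additive_group x \<alpha> = \<alpha>"
proof -
  have "((\<lambda>y. x + y) has_derivative (\<lambda>h. h)) (at 0)"
    by (auto intro!: derivative_eq_intros)
  then have "tangent_left additive_group x = (\<lambda>h. h)"
    by (simp add: tangent_left_def tangent_map_def additive_group_def frechet_derivative_at[symmetric])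
  then show ?thesis by (intro blinfun_eqI) (simp add: cotangent_left_apply)
qed

lemma differential_apply:
  assumes "((\<lambda>u. f (chart_inv c p u)) has_derivative f') (at (chart_map c p p))"
  shows "blinfun_apply (differential c f p) = f'"
  using assms frechet_derivative_at[OF assms]
  by (simp add: differential_def tangent_map_def o_def bounded_linear_Blinfun_apply has_derivative_bounded_linear)

context lie_group
begin

text \<open>
  Joint differentiability of \<open>L\<close> in the charts makes all the differentials restrictions of a single linear map
  \<open>F'\<close> to coordinate subspaces.
\<close>

lemma lagrangian_partials:
  assumes L: "smooth_lagrangian T2 L"
  shows "blinfun_apply (partial_group T2 L (g, \<xi>1, \<xi>2) (\<eta>0, \<eta>1, \<eta>2)) (h0, h1, h2) =
      partial_g G L (g, \<xi>1, \<xi>2) (\<eta>0, \<eta>1, \<eta>2) h0 +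
      partial_xi1 L (g, \<xi>1, \<xi>2) (\<eta>0, \<eta>1, \<eta>2) h1 + partial_xi2 L (g, \<xi>1, \<xi>2) (\<eta>0, \<eta>1, \<eta>2) h2" (is ?group)
    and "blinfun_apply (partial_algebra L (g, \<xi>1, \<xi>2) (\<eta>0, \<eta>1, \<eta>2)) (h0, h1, h2) =
      partial_eta0 L (g, \<xi>1, \<xi>2) (\<eta>0, \<eta>1, \<eta>2) h0 +
      partial_eta1 L (g, \<xi>1, \<xi>2) (\<eta>0, \<eta>1, \<eta>2) h1 + partial_eta2 L (g, \<xi>1, \<xi>2) (\<eta>0, \<eta>1, \<eta>2) h2" (is ?algebra)
proof -
  let ?u = "chart_map (charts G) g g" and ?V = "chart_map (charts G) g ` chart_dom (charts G) g"
  let ?cc = "prod_charts (times_vec2 (charts G)) vec_charts"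
  define F where "F z = (\<lambda>((u, s, t), \<eta>). L (chart_inv (charts G) g u, s, t) \<eta>) z" for z
  have uV: "?u \<in> ?V" using chart_dom_self[OF atlas] by blast
  have near: "\<forall>\<^sub>F z in nhds ((?u, \<xi>1, \<xi>2), (\<eta>0, \<eta>1, \<eta>2)). z \<in> (?V \<times> UNIV) \<times> UNIV"
    using uV open_chart_image[OF atlas] by (intro eventually_nhds_in_open open_Times) auto
  have "(chart_map vec_charts 0 \<circ> (\<lambda>(k, \<xi>). L k \<xi>) \<circ> chart_inv ?cc ((g, \<xi>1, \<xi>2), (\<eta>0, \<eta>1, \<eta>2)))
      differentiable (at (chart_map ?cc ((g, \<xi>1, \<xi>2), (\<eta>0, \<eta>1, \<eta>2)) ((g, \<xi>1, \<xi>2), (\<eta>0, \<eta>1, \<eta>2))))"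
    using L unfolding smooth_lagrangian_def second_tangent_group_simps
    by (rule smooth_map_differentiable) (simp_all add: chart_dom_self[OF atlas])
  then obtain F' where "((chart_map vec_charts 0 \<circ> (\<lambda>(k, \<xi>). L k \<xi>) \<circ>
      chart_inv ?cc ((g, \<xi>1, \<xi>2), (\<eta>0, \<eta>1, \<eta>2))) has_derivative F') (at ((?u, \<xi>1, \<xi>2), (\<eta>0, \<eta>1, \<eta>2)))"
    by (auto simp: differentiable_def)
  then have F': "(F has_derivative F') (at ((?u, \<xi>1, \<xi>2), (\<eta>0, \<eta>1, \<eta>2)))"
  proof (rule has_derivative_transform_nhds)
    show "\<forall>\<^sub>F z in nhds ((?u, \<xi>1, \<xi>2), (\<eta>0, \<eta>1, \<eta>2)).
        (chart_map vec_charts 0 \<circ> (\<lambda>(k, \<xi>). L k \<xi>) \<circ> chart_inv ?cc ((g, \<xi>1, \<xi>2), (\<eta>0, \<eta>1, \<eta>2))) z = F z"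
      using near
    proof eventually_elim
      case (elim z)
      obtain u s t \<eta> where z: "z = ((u, s, t), \<eta>)" by (metis surj_pair)
      have "chart_inv ?cc ((g, \<xi>1, \<xi>2), (\<eta>0, \<eta>1, \<eta>2)) ((u, s, t), \<eta>) =
          (chart_inv (times_vec2 (charts G)) (g, \<xi>1, \<xi>2) (u, s, t), chart_inv vec_charts (\<eta>0, \<eta>1, \<eta>2) \<eta>)"
        using elim by (intro chart_inv_prod topological_atlas_prod) (auto simp: z atlas map_prod_surj_on prod.map_id0)
      then show ?case
        using elim by (simp add: z F_def chart_inv_times_vec2[OF atlas])
    qed
  qed
  have lin: "linear F'" by (rule has_derivative_linear[OF F'])
  have along: "((\<lambda>x. F (j x)) has_derivative (\<lambda>h. F' (j' h))) (at x)"
    if "(j has_derivative j') (at x)" "j x = ((?u, \<xi>1, \<xi>2), (\<eta>0, \<eta>1, \<eta>2))" for j j' x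
    using has_derivative_compose[OF that(1), of F F'] F' that(2) by simp
  have group: "blinfun_apply (partial_group T2 L (g, \<xi>1, \<xi>2) (\<eta>0, \<eta>1, \<eta>2)) = (\<lambda>h. F' (h, 0))"
    unfolding partial_group_def
  proof (rule differential_apply)
    have "((\<lambda>z. F (z, (\<eta>0, \<eta>1, \<eta>2))) has_derivative (\<lambda>h. F' (h, 0))) (at (?u, \<xi>1, \<xi>2))"
      by (rule along) (auto intro!: derivative_eq_intros)
    then have "((\<lambda>z. L (chart_inv (times_vec2 (charts G)) (g, \<xi>1, \<xi>2) z) (\<eta>0, \<eta>1, \<eta>2)) has_derivative
        (\<lambda>h. F' (h, 0))) (at (?u, \<xi>1, \<xi>2))"
    proof (rule has_derivative_transform_nhds)
      have "\<forall>\<^sub>F z in nhds (?u, \<xi>1, \<xi>2). z \<in> ?V \<times> UNIV"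
        using uV open_chart_image[OF atlas] by (intro eventually_nhds_in_open open_Times) auto
      then show "\<forall>\<^sub>F z in nhds (?u, \<xi>1, \<xi>2). F (z, (\<eta>0, \<eta>1, \<eta>2)) =
          L (chart_inv (times_vec2 (charts G)) (g, \<xi>1, \<xi>2) z) (\<eta>0, \<eta>1, \<eta>2)"
        by eventually_elim (auto simp: F_def chart_inv_times_vec2[OF atlas])
    qed
    then show "((\<lambda>z. L (chart_inv (charts T2) (g, \<xi>1, \<xi>2) z) (\<eta>0, \<eta>1, \<eta>2)) has_derivative
        (\<lambda>h. F' (h, 0))) (at (chart_map (charts T2) (g, \<xi>1, \<xi>2) (g, \<xi>1, \<xi>2)))"
      by simp
  qed
  note const = has_derivative_const and var = has_derivative_ident and pair = has_derivative_Pair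
  have gg: "chart_inv (charts G) g ?u = g" by (rule chart_inv_map[OF atlas chart_dom_self[OF atlas]])
  have algebra: "blinfun_apply (partial_algebra L (g, \<xi>1, \<xi>2) (\<eta>0, \<eta>1, \<eta>2)) = (\<lambda>h. F' (0, h))"
    unfolding partial_algebra_def
    by (rule differential_apply)
       (use along[of "\<lambda>h. ((?u, \<xi>1, \<xi>2), h)" "\<lambda>h. (0, h)" "(\<eta>0, \<eta>1, \<eta>2)",
          OF pair[OF const var]] in
         \<open>simp add: F_def gg\<close>)
  have g: "blinfun_apply (partial_g G L (g, \<xi>1, \<xi>2) (\<eta>0, \<eta>1, \<eta>2)) = (\<lambda>h. F' ((h, 0, 0), 0))"
    unfolding partial_g.simps
    by (rule differential_apply)
       (use along[of "\<lambda>h. ((h, \<xi>1, \<xi>2), (\<eta>0, \<eta>1, \<eta>2))" "\<lambda>h. ((h, 0, 0), 0)" ?u,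
          OF pair[OF pair[OF var pair[OF const const]] const]] in
         \<open>simp add: F_def gg\<close>)
  have xi1: "blinfun_apply (partial_xi1 L (g, \<xi>1, \<xi>2) (\<eta>0, \<eta>1, \<eta>2)) = (\<lambda>h. F' ((0, h, 0), 0))"
    unfolding partial_xi1.simps
    by (rule differential_apply)
       (use along[of "\<lambda>h. ((?u, h, \<xi>2), (\<eta>0, \<eta>1, \<eta>2))" "\<lambda>h. ((0, h, 0), 0)" \<xi>1,
          OF pair[OF pair[OF const pair[OF var const]] const]] in
         \<open>simp add: F_def gg\<close>)
  have xi2: "blinfun_apply (partial_xi2 L (g, \<xi>1, \<xi>2) (\<eta>0, \<eta>1, \<eta>2)) = (\<lambda>h. F' ((0, 0, h), 0))"
    unfolding partial_xi2.simps
    by (rule differential_apply)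
       (use along[of "\<lambda>h. ((?u, \<xi>1, h), (\<eta>0, \<eta>1, \<eta>2))" "\<lambda>h. ((0, 0, h), 0)" \<xi>2,
          OF pair[OF pair[OF const pair[OF const var]] const]] in
         \<open>simp add: F_def gg\<close>)
  have eta0: "blinfun_apply (partial_eta0 L (g, \<xi>1, \<xi>2) (\<eta>0, \<eta>1, \<eta>2)) = (\<lambda>h. F' (0, (h, 0, 0)))"
    unfolding partial_eta0.simps
    by (rule differential_apply)
       (use along[of "\<lambda>h. ((?u, \<xi>1, \<xi>2), (h, \<eta>1, \<eta>2))" "\<lambda>h. (0, (h, 0, 0))" \<eta>0,
          OF pair[OF const pair[OF var pair[OF const const]]]] in
         \<open>simp add: F_def gg\<close>)
  have eta1: "blinfun_apply (partial_eta1 L (g, \<xi>1, \<xi>2) (\<eta>0, \<eta>1, \<eta>2)) = (\<lambda>h. F' (0, (0, h, 0)))"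
    unfolding partial_eta1.simps
    by (rule differential_apply)
       (use along[of "\<lambda>h. ((?u, \<xi>1, \<xi>2), (\<eta>0, h, \<eta>2))" "\<lambda>h. (0, (0, h, 0))" \<eta>1,
          OF pair[OF const pair[OF const pair[OF var const]]]] in
         \<open>simp add: F_def gg\<close>)
  have eta2: "blinfun_apply (partial_eta2 L (g, \<xi>1, \<xi>2) (\<eta>0, \<eta>1, \<eta>2)) = (\<lambda>h. F' (0, (0, 0, h)))"
    unfolding partial_eta2.simps
    by (rule differential_apply)
       (use along[of "\<lambda>h. ((?u, \<xi>1, \<xi>2), (\<eta>0, \<eta>1, h))" "\<lambda>h. (0, (0, 0, h))" \<eta>2,
          OF pair[OF const pair[OF const pair[OF const var]]]] in
         \<open>simp add: F_def gg\<close>)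
  show ?group ?algebra
    unfolding group algebra g xi1 xi2 eta0 eta1 eta2
    by (simp_all add: linear_add[OF lin, symmetric])
qed

end

text \<open>
  A curve in the dual of a product corresponds to a triple of curves in the duals of the factors through
  composition with the injections \<open>i0\<close>, \<open>i1\<close>, \<open>i2\<close> and the projections \<open>p0\<close>, \<open>p1\<close>, \<open>p2\<close>, which is
  bounded linear in both directions.
\<close>

lemma has_vector_derivative_triple_dual:
  fixes M :: "real \<Rightarrow> ('a::real_normed_vector \<times> 'b::real_normed_vector \<times> 'c::real_normed_vector) \<Rightarrow>\<^sub>L real"
    and M0 :: "real \<Rightarrow> 'a \<Rightarrow>\<^sub>L real" and M1 :: "real \<Rightarrow> 'b \<Rightarrow>\<^sub>L real" and M2 :: "real \<Rightarrow> 'c \<Rightarrow>\<^sub>L real"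
    and D :: "('a \<times> 'b \<times> 'c) \<Rightarrow>\<^sub>L real"
    and D0 :: "'a \<Rightarrow>\<^sub>L real" and D1 :: "'b \<Rightarrow>\<^sub>L real" and D2 :: "'c \<Rightarrow>\<^sub>L real"
  assumes M: "\<And>s a b c. M s (a, b, c) = M0 s a + M1 s b + M2 s c"
    and D: "\<And>a b c. D (a, b, c) = D0 a + D1 b + D2 c"
  shows "(M has_vector_derivative D) (at t) \<longleftrightarrow>
    ((\<lambda>s. M0 s) has_vector_derivative D0) (at t) \<and>
    ((\<lambda>s. M1 s) has_vector_derivative D1) (at t) \<and>
    ((\<lambda>s. M2 s) has_vector_derivative D2) (at t)"
proof -
  define i0 :: "'a \<Rightarrow>\<^sub>L ('a \<times> 'b \<times> 'c)" where "i0 = Blinfun (\<lambda>a. (a, 0, 0))"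
  define i1 :: "'b \<Rightarrow>\<^sub>L ('a \<times> 'b \<times> 'c)" where "i1 = Blinfun (\<lambda>b. (0, b, 0))"
  define i2 :: "'c \<Rightarrow>\<^sub>L ('a \<times> 'b \<times> 'c)" where "i2 = Blinfun (\<lambda>c. (0, 0, c))"
  define p0 :: "('a \<times> 'b \<times> 'c) \<Rightarrow>\<^sub>L 'a" where "p0 = Blinfun fst"
  define p1 :: "('a \<times> 'b \<times> 'c) \<Rightarrow>\<^sub>L 'b" where "p1 = Blinfun (\<lambda>x. fst (snd x))"
  define p2 :: "('a \<times> 'b \<times> 'c) \<Rightarrow>\<^sub>L 'c" where "p2 = Blinfun (\<lambda>x. snd (snd x))"
  have i: "i0 a = (a, 0, 0)" "i1 b = (0, b, 0)" "i2 c = (0, 0, c)" for a b c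
    unfolding i0_def i1_def i2_def
    by (subst bounded_linear_Blinfun_apply;
        (intro bounded_linear_Pair bounded_linear_zero bounded_linear_ident)?; simp)+
  have p: "p0 x = fst x" "p1 x = fst (snd x)" "p2 x = snd (snd x)" for x
    unfolding p0_def p1_def p2_def
    by (subst bounded_linear_Blinfun_apply;
        (intro bounded_linear_fst_comp bounded_linear_snd_comp bounded_linear_ident bounded_linear_fst)?; simp)+
  have M0: "M s o\<^sub>L i0 = M0 s" "M s o\<^sub>L i1 = M1 s" "M s o\<^sub>L i2 = M2 s" for s
    by (auto intro!: blinfun_eqI simp: i M blinfun.zero_right)
  have D0: "D o\<^sub>L i0 = D0" "D o\<^sub>L i1 = D1" "D o\<^sub>L i2 = D2"
    by (auto intro!: blinfun_eqI simp: i D blinfun.zero_right)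
  have Ms: "(M0 s o\<^sub>L p0) + (M1 s o\<^sub>L p1) + (M2 s o\<^sub>L p2) = M s" for s
    by (rule blinfun_eqI) (auto simp: p M blinfun.add_left)
  have Ds: "(D0 o\<^sub>L p0) + (D1 o\<^sub>L p1) + (D2 o\<^sub>L p2) = D"
    by (rule blinfun_eqI) (auto simp: p D blinfun.add_left)
  note comp = bounded_linear.has_vector_derivative[OF
      bounded_bilinear.bounded_linear_left[OF bounded_bilinear_blinfun_compose]]
  show ?thesis
  proof (intro iffI conjI)
    assume *: "(M has_vector_derivative D) (at t)"
    show "((\<lambda>s. M0 s) has_vector_derivative D0) (at t)" using comp[OF *, of i0] by (simp add: M0 D0)
    show "((\<lambda>s. M1 s) has_vector_derivative D1) (at t)" using comp[OF *, of i1] by (simp add: M0 D0)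
    show "((\<lambda>s. M2 s) has_vector_derivative D2) (at t)" using comp[OF *, of i2] by (simp add: M0 D0)
  next
    assume *: "((\<lambda>s. M0 s) has_vector_derivative D0) (at t) \<and>
      ((\<lambda>s. M1 s) has_vector_derivative D1) (at t) \<and> ((\<lambda>s. M2 s) has_vector_derivative D2) (at t)"
    have "((\<lambda>s. (M0 s o\<^sub>L p0) + (M1 s o\<^sub>L p1) + (M2 s o\<^sub>L p2)) has_vector_derivative
        (D0 o\<^sub>L p0) + (D1 o\<^sub>L p1) + (D2 o\<^sub>L p2)) (at t)"
      using * by (intro has_vector_derivative_add comp) auto
    then show "(M has_vector_derivative D) (at t)" by (simp add: Ms Ds)
  qed
qed

section \<open>The Euler-Lagrange equations\<close>

theorem proposition5p5:
  fixes G :: "('g::t2_space, 'e::real_normed_vector) lie_group_data"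
    and L :: "'g \<times> 'e \<times> 'e \<Rightarrow> 'e \<times> 'e \<times> 'e \<Rightarrow> real"
    and g :: "real \<Rightarrow> 'g" and \<xi>1 \<xi>2 \<eta>0 \<eta>1 \<eta>2 :: "real \<Rightarrow> 'e"
    and k :: "real \<Rightarrow> 'g \<times> 'e \<times> 'e" and \<eta> :: "real \<Rightarrow> 'e \<times> 'e \<times> 'e"
    and t :: real
  assumes "lie_group G"
    and "smooth_lagrangian (second_tangent_group G) L"
    and "\<And>s. k s = (g s, \<xi>1 s, \<xi>2 s)"
    and "\<And>s. \<eta> s = (\<eta>0 s, \<eta>1 s, \<eta>2 s)"
  shows "euler_lagrange_at (second_tangent_group G) L k \<eta> t \<longleftrightarrow>
    ((\<lambda>s. partial_eta0 L (k s) (\<eta> s)) has_vector_derivative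
       (cotangent_left G (g t) (partial_g G L (k t) (\<eta> t))
        - coad G (\<xi>1 t) (partial_xi1 L (k t) (\<eta> t))
        - coad G (\<xi>2 t) (partial_xi2 L (k t) (\<eta> t))
        - coad G (\<eta>0 t) (partial_eta0 L (k t) (\<eta> t))
        - coad G (\<eta>1 t) (partial_eta1 L (k t) (\<eta> t))
        - coad G (\<eta>2 t) (partial_eta2 L (k t) (\<eta> t)))) (at t) \<and>
    ((\<lambda>s. partial_eta1 L (k s) (\<eta> s)) has_vector_derivative
       (partial_xi1 L (k t) (\<eta> t)
        - coad G (\<xi>1 t) (partial_xi2 L (k t) (\<eta> t))
        - coad G (\<eta>0 t) (partial_eta1 L (k t) (\<eta> t))
        - 2 *\<^sub>R coad G (\<eta>1 t) (partial_eta2 L (k t) (\<eta> t)))) (at t) \<and>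
    ((\<lambda>s. partial_eta2 L (k s) (\<eta> s)) has_vector_derivative
       (cotangent_left additive_group (\<xi>2 t) (partial_xi2 L (k t) (\<eta> t))
        - coad G (\<eta>0 t) (partial_eta2 L (k t) (\<eta> t)))) (at t)"
proof -
  interpret lie_group G by fact
  note partials = lagrangian_partials[OF assms(2)]
  show ?thesis
    unfolding euler_lagrange_at_def
  proof (rule has_vector_derivative_triple_dual)
    fix s a b c
    show "blinfun_apply (partial_algebra L (k s) (\<eta> s)) (a, b, c) =
        partial_eta0 L (k s) (\<eta> s) a + partial_eta1 L (k s) (\<eta> s) b + partial_eta2 L (k s) (\<eta> s) c"
      unfolding assms(3,4) by (rule partials(2))
  next
    fix a b c
    \<comment> \<open>The transpose of \<open>h \<mapsto> - [h, a]\<close> is \<open>- ad\<^sup>*\<close> of \<open>a\<close> only after the arguments of the bracket are exchanged.\<close>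
    have ad_swap: "blinfun_apply \<mu> (ad G x y) = - blinfun_apply \<mu> (ad G y x)" for \<mu> x y
      by (subst ad_antisym) (rule blinfun.minus_right)
    show "blinfun_apply (cotangent_left T2 (k t) (partial_group T2 L (k t) (\<eta> t)) -
          coad T2 (\<eta> t) (partial_algebra L (k t) (\<eta> t))) (a, b, c) =
        blinfun_apply (cotangent_left G (g t) (partial_g G L (k t) (\<eta> t))
        - coad G (\<xi>1 t) (partial_xi1 L (k t) (\<eta> t))
        - coad G (\<xi>2 t) (partial_xi2 L (k t) (\<eta> t))
        - coad G (\<eta>0 t) (partial_eta0 L (k t) (\<eta> t))
        - coad G (\<eta>1 t) (partial_eta1 L (k t) (\<eta> t))
        - coad G (\<eta>2 t) (partial_eta2 L (k t) (\<eta> t))) a +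
        blinfun_apply (partial_xi1 L (k t) (\<eta> t)
        - coad G (\<xi>1 t) (partial_xi2 L (k t) (\<eta> t))
        - coad G (\<eta>0 t) (partial_eta1 L (k t) (\<eta> t))
        - 2 *\<^sub>R coad G (\<eta>1 t) (partial_eta2 L (k t) (\<eta> t))) b +
        blinfun_apply (cotangent_left additive_group (\<xi>2 t) (partial_xi2 L (k t) (\<eta> t))
        - coad G (\<eta>0 t) (partial_eta2 L (k t) (\<eta> t))) c"
      unfolding assms(3,4)
      by (simp only: blinfun.diff_left blinfun.scaleR_left cotangent_left_additive_group
          cotangent_left_apply[OF bounded_linear_tangent_left_T2] coad_apply[OF bounded_linear_ad_T2]
          cotangent_left_apply[OF bounded_linear_tangent_left] coad_apply[OF bounded_linear_ad_right]
          tangent_left_T2 ad_T2 partials blinfun.add_right blinfun.diff_right blinfun.scaleR_right)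
         (simp add: ad_swap[of _ a] ad_swap[of _ b])
  qed
qed

end
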